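(* Let $q$ be any prime power. The following identities hold in $K_\infty=\mathbb{F}_q((1/t))$. (1) For all integers $n>0$, $1\le s<q$ and $k_1,\dots,k_s$ (not necessarily distinct) with $0\le k_i<n$, $$\zeta\Big(q^n-\sum_{i=1}^s q^{k_i},\ (q-1)q^n\Big)=\frac{(-1)^s}{\ell_1^{q^n}}\ \prod_{i=1}^s [n-k_i]^{q^{k_i}}\ \zeta\Big(q^{n+1}-\sum_{i=1}^s q^{k_i}\Big).$$ (2) For all integers $n\ge 0$, $1\le s_1\le q$, $0\le s_2\le q-s_1$ and $k_1,\dots,k_{s_2}$ (not necessarily distinct) with $0\le k_i\le n+1$, setting $a=s_1q^n$ and $b=s_1(q^{n+1}-q^n)+\sum_{i=1}^{s_2}(q^{n+1}-q^{k_i})$, $$\zeta(a,b)=\frac{1}{\ell_1^{s_1q^n}}\ \zeta(a+b).$$ (3) $$\zeta\big(q^2-(q-1),\ (q-1)(q^2+1)\big)=\frac{1-[2]^q}{\ell_1^{q^2-1}\,\ell_2}\ \zeta(q^3).$$ (4) $$\zeta\big(2q-1,\ (q-1)(q^2+q-1)\big)=\frac{1-[2]^q}{\ell_1^{q+1}\,\ell_2^{q-1}}\ \zeta(q^3).$$ (5) $$\zeta(1,q^2-1)=\zeta(q^2)\left(\frac{1}{\ell_1}+\frac{1}{\ell_2}\right).$$ (6) If $q>2$, then for all integers $n\ge 0$ and $-1\le j\le n$, $$\zeta\big((q-1)q^n-1,\ (q-1)q^{n+1}+q^n-q^{n-j}\big)=-\frac{[n+1]}{[1]^{(q-1)q^n}}\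 \zeta\big(q^{n+2}-q^{n-j}-1\big).$$
   Context: Let $q$ be a power of a prime, $A=\mathbb{F}_q[t]$, $K=\mathbb{F}_q(t)$, and $K_\infty=\mathbb{F}_q((1/t))$ the completion of $K$ at the place $\infty$. For $d\ge 0$, let $A_{d^+}$ be the set of monic polynomials of degree $d$ in $A$. For an integer $n\ge 1$ put $[n]=t^{q^n}-t$ and $\ell_n=\prod_{i=1}^n(t-t^{q^i})$. For positive integers $s$ and $d\ge 0$, put $S_d(s)=\sum_{a\in A_{d^+}} a^{-s}\in K$. For positive integers $s_1,\dots,s_r$ ($r\ge 1$), the multizeta value is $$\zeta(s_1,\dots,s_r)=\sum_{d_1>\cdots>d_r\ge 0}S_{d_1}(s_1)\cdots S_{d_r}(s_r)\in K_\infty,$$ i.e. the sum of $a_1^{-s_1}\cdots a_r^{-s_r}$ over monic $a_i\in A$ with $\deg a_1>\cdots>\deg a_r\ge 0$ (convergent in $K_\infty$). For $r=1$ this is the Carlitz zeta value $\zeta(s)=\sum_{d\ge 0}S_d(s)$. Empty sums are $0$. *)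

theory Defs
  imports "HOL-Analysis.Infinite_Sum" "HOL-Library.Cardinality" "HOL-Computational_Algebra.Computational_Algebra"
begin

text \<open>
  The field \<open>F\<^sub>q\<close> is a type \<^typ>\<open>'a\<close> of sort \<open>{field, finite}\<close> with \<open>q = CARD('a)\<close>, and
  \<open>A\<close> is \<^typ>\<open>'a poly\<close>.  The completion of \<open>K\<close> at infinity is \<^typ>\<open>'a fls\<close>, the Laurent series
  in the variable \<open>fls_X = 1/t\<close>; hence \<open>t\<close> is \<open>fls_X_inv\<close>.  The library metric on \<^typ>\<open>'a fls\<close>
  (\<open>dist f g = 2 powi - fls_subdegree (f - g)\<close> for \<open>f \<noteq> g\<close>) induces the \<open>1/t\<close>-adic topology.
\<close>

definition tt :: "'a::field fls" where
  "tt = fls_X_inv"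

text \<open>The inclusion of \<open>A\<close> into its completion at infinity: \<open>p\<close> is sent to \<open>p(t)\<close>.\<close>

definition of_A :: "'a::field poly \<Rightarrow> 'a fls" where
  "of_A p = poly (map_poly fls_const p) tt"

definition A_monic :: "nat \<Rightarrow> 'a::field poly set" where
  "A_monic d = {a. lead_coeff a = 1 \<and> degree a = d}"

definition bracket :: "nat \<Rightarrow> 'a::{field,finite} fls" where
  "bracket n = tt ^ (CARD('a) ^ n) - tt"

definition ell :: "nat \<Rightarrow> 'a::{field,finite} fls" where
  "ell n = (\<Prod>i=1..n. tt - tt ^ (CARD('a) ^ i))"

definition S_sum :: "nat \<Rightarrow> nat \<Rightarrow> 'a::{field,finite} fls" where
  "S_sum d s = (\<Sum>a\<in>A_monic d. inverse (of_A a ^ s))"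

text \<open>
  The list \<open>ss = [s\<^sub>1, \<dots>, s\<^sub>r]\<close> is meant to be nonempty with positive entries.  Then the
  family below tends to zero in the complete non-archimedean field \<^typ>\<open>'a fls\<close>, as the summand at
  \<open>ds\<close> has \<open>1/t\<close>-adic valuation at least \<open>\<Sum>i<r. ds ! i * ss ! i\<close>; it is therefore summable and
  \<^const>\<open>infsum\<close> is its actual sum.
\<close>

definition zeta :: "nat list \<Rightarrow> 'a::{field,finite} fls" where
  "zeta ss = infsum (\<lambda>ds. \<Prod>i<length ss. S_sum (ds ! i) (ss ! i))
               {ds. length ds = length ss \<and> sorted_wrt (>) ds}"

end

theory Submission
  imports Defs
begin

text \<open>
  Write \<open>S_below d s\<close> for the sum of \<open>S_sum j s\<close> over \<open>j < d\<close>.  Every identity comes from a termwise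
  relation \<open>S_sum (d+1) a * S_below (d+1) b = C * S_sum d (a+b) + C' * S_sum (d-1) (a+b)\<close>,
  whose last term is absent for \<open>d = 0\<close>.

  The exponents occurring have the form \<open>r q^n - (q^k1 + ... + q^ks)\<close>.  On the space of polynomials
  of degree below \<open>d\<close>, the linear map sending \<open>a^(q^n)\<close> to \<open>a^(q^k)\<close> is interpolated by a linear
  polynomial of degree at most \<open>q^(d-1)\<close>.  A product of at most \<open>q\<close> of these, divided by the variable,
  still has degree below the number of points, so by Lagrange interpolation its sum over the nonzero
  points only sees its value at \<open>0\<close> or its top coefficient.  This makes the power sums multiplicative
  and reduces them to the exponents \<open>q^n - q^k\<close>.  For those, the sum of \<open>a(T) / a(\<theta>)\<close> over monic \<open>a\<close>
  of degree \<open>d\<close> is a polynomial in \<open>T\<close> with the roots \<open>\<theta>^(q^i)\<close>, \<open>i < d\<close>, which gives closed formulas.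
\<close>

text \<open>There are three product formulas, and the count of factors each one tolerates comes from
  a degree count. When all degrees up to \<open>d\<close> are summed and the denominator power
  equals the number of factors, up to q factors are allowed, because q(q^d - 1) < q^(d+1) - 1 and
  only the value at 0 survives. For a single degree \<open>d\<close>, padding with the form
  \<open>coeff a d\<close> works if the denominator power exceeds the number of factors. If instead
  the denominator has power one, an extra factor X^(q-1) pushes the degree bound to exactly q^(d+1)
  - 1, and the top coefficients survive. The conditions \<open>s < q\<close>,
  \<open>s1 + s2 \<le> q\<close> and \<open>q > 2\<close> of the identities are these counts. After
  that every identity is a cancellation among values of \<open>ell\<close>. A second term, and with
  it the shape 1 - [2]^q or 1/ell_1 + 1/ell_2, arises when a Frobenius power of tt - tt^(q^(d+2)) is
  left over: it splits into a constant and the factor that turns \<open>S_sum d\<close> into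
  \<open>S_sum (d-1)\<close>.\<close>

section \<open>The q-power Frobenius on Laurent series over a finite field\<close>

lemma card_ge_2: "CARD('a::{field,finite}) \<ge> 2"
proof -
  have "card {0, 1 :: 'a} \<le> CARD('a)" by (intro card_mono) auto
  thus ?thesis by simp
qed

lemma card_gt_0: "CARD('a::{field,finite}) > 0"
  using card_ge_2[where ?'a = 'a] by linarith

lemma power_card_eq_self:
  fixes x :: "'a::{field,finite}"
  shows "x ^ CARD('a) = x"
proof (cases "x = 0")
  case False
  have "(\<Prod>y\<in>UNIV-{0}. x * y) = (\<Prod>y\<in>UNIV-{0::'a}. y)"
    by (rule prod.reindex_bij_witness[of _ "\<lambda>y. y / x" "\<lambda>y. x * y"]) (use False in auto)
  hence "x ^ (CARD('a) - 1) * (\<Prod>y\<in>UNIV-{0::'a}. y) = (\<Prod>y\<in>UNIV-{0::'a}. y)"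
    by (simp add: prod.distrib)
  hence "x ^ (CARD('a) - 1) = 1" by simp
  thus ?thesis using card_gt_0[where ?'a = 'a]
    by (metis mult.right_neutral power_minus_mult mult.commute)
qed (use card_gt_0[where ?'a = 'a] in auto)

lemma of_nat_card_eq_0: "of_nat CARD('a) = (0 :: 'a::{field,finite})"
proof -
  have "(\<Sum>x\<in>UNIV. x + 1) = (\<Sum>x\<in>UNIV. x :: 'a)"
    by (rule sum.reindex_bij_witness[of _ "\<lambda>x. x - 1" "\<lambda>x. x + 1"]) auto
  thus ?thesis by (simp add: sum.distrib)
qed

lemma of_nat_card_fls: "of_nat CARD('a) = (0 :: 'a::{field,finite} fls)"
  by (simp add: fls_of_nat of_nat_card_eq_0)

text \<open>
  The polynomial \<open>(X + 1)\<^sup>q - X\<^sup>q - 1\<close> over \<open>F\<^sub>q\<close> has degree below \<open>q\<close> and \<open>q\<close> roots, so it is zero.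
\<close>
lemma of_nat_choose_card_eq_0:
  assumes "0 < k" "k < CARD('a)"
  shows "of_nat (CARD('a) choose k) = (0 :: 'a::{field,finite})"
proof -
  let ?q = "CARD('a)"
  let ?p = "\<Sum>k\<in>{1..<?q}. monom (of_nat (?q choose k) :: 'a) k"
  have "poly ?p x = 0" for x
  proof -
    have eq: "{..?q} = insert 0 (insert ?q {1..<?q})" using card_gt_0[where ?'a = 'a] by auto
    have "x + 1 = (x + 1) ^ ?q" by (simp add: power_card_eq_self)
    also have "\<dots> = (\<Sum>k\<le>?q. of_nat (?q choose k) * x ^ k)"
      by (subst binomial_ring) simp
    also have "\<dots> = 1 + x ^ ?q + (\<Sum>k\<in>{1..<?q}. of_nat (?q choose k) * x ^ k)"
      unfolding eq using card_gt_0[where ?'a = 'a] by (subst sum.insert; simp)+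
    finally show ?thesis by (simp add: poly_sum poly_monom power_card_eq_self)
  qed
  moreover have "degree ?p < card (UNIV :: 'a set)"
  proof -
    have "degree ?p \<le> ?q - 1"
      by (intro degree_sum_le) (auto intro: order_trans[OF degree_monom_le])
    thus ?thesis using card_gt_0[where ?'a = 'a] by linarith
  qed
  ultimately have "?p = 0"
    by (intro poly_eqI_degree[of UNIV]) auto
  hence "coeff ?p k = 0" by simp
  thus ?thesis using assms by (simp add: coeff_sum)
qed

lemma frobenius_add:
  fixes x y :: "'a::{field,finite} fls"
  shows "(x + y) ^ CARD('a) = x ^ CARD('a) + y ^ CARD('a)"
proof -
  let ?q = "CARD('a)"
  have eq: "{..?q} = insert 0 (insert ?q {1..<?q})" using card_gt_0[where ?'a = 'a] by auto
  have "(x + y) ^ ?q = (\<Sum>k\<le>?q. of_nat (?q choose k) * x ^ k * y ^ (?q - k))"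
    by (rule binomial_ring)
  also have "\<dots> = y ^ ?q + x ^ ?q + (\<Sum>k\<in>{1..<?q}. of_nat (?q choose k) * x ^ k * y ^ (?q - k))"
    unfolding eq using card_gt_0[where ?'a = 'a] by (subst sum.insert; simp)+
  also have "(\<Sum>k\<in>{1..<?q}. of_nat (?q choose k) * x ^ k * y ^ (?q - k)) = 0"
    by (intro sum.neutral) (auto simp: fls_of_nat of_nat_choose_card_eq_0)
  finally show ?thesis by simp
qed

lemma frobenius_pow_add:
  fixes x y :: "'a::{field,finite} fls"
  shows "(x + y) ^ (CARD('a) ^ n) = x ^ (CARD('a) ^ n) + y ^ (CARD('a) ^ n)"
proof (induction n)
  case (Suc n)
  have "z ^ (CARD('a) ^ Suc n) = (z ^ (CARD('a) ^ n)) ^ CARD('a)" for z :: "'a fls"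
    by (simp add: power_mult mult.commute flip: power_mult)
  thus ?case by (simp only: Suc frobenius_add)
qed simp

lemma frobenius_pow_sum:
  fixes f :: "'b \<Rightarrow> 'a::{field,finite} fls"
  shows "(\<Sum>i\<in>A. f i) ^ (CARD('a) ^ n) = (\<Sum>i\<in>A. f i ^ (CARD('a) ^ n))"
  using card_gt_0[where ?'a = 'a]
  by (induction A rule: infinite_finite_induct) (auto simp: frobenius_pow_add power_0_left)

lemma frobenius_pow_diff:
  fixes x y :: "'a::{field,finite} fls"
  shows "(x - y) ^ (CARD('a) ^ n) = x ^ (CARD('a) ^ n) - y ^ (CARD('a) ^ n)"
  using frobenius_pow_add[of "x - y" y n] by simp

lemma fls_const_frobenius: "fls_const (c::'a::{field,finite}) ^ (CARD('a) ^ n) = fls_const c"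
proof (induction n)
  case (Suc n)
  have "fls_const c ^ (CARD('a) ^ Suc n) = (fls_const c ^ (CARD('a) ^ n)) ^ CARD('a)"
    by (simp add: mult.commute flip: power_mult)
  thus ?case using Suc by (simp add: fls_const_power power_card_eq_self flip: fls_const_power)
qed simp

section \<open>Interpolation by linear polynomials\<close>

text \<open>Vanishing coefficients replace a degree bound because \<open>degree 0 = 0\<close>: this
  way 0 belongs to the space even for \<open>d = 0\<close>, and closure under linear combinations
  needs no case distinction.\<close>

definition polys_below :: "nat \<Rightarrow> 'a::zero poly set" where
  "polys_below d = {a. \<forall>i\<ge>d. coeff a i = 0}"

definition Fq_linear :: "('a::field poly \<Rightarrow> 'a fls) \<Rightarrow> bool" where
  "Fq_linear l \<longleftrightarrow> (\<forall>a b. l (a + b) = l a + l b) \<and> (\<forall>c a. l (smult c a) = fls_const c * l a)"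

text \<open>Linearity is asked of the polynomial function. Over a finite \<open>'a\<close> with q
  elements, the field \<open>'a fls\<close> being infinite, these are the polynomials involving only
  the monomials X^(q^i).\<close>

definition linear_poly :: "'a::field fls poly \<Rightarrow> bool" where
  "linear_poly p \<longleftrightarrow> (\<forall>x y. poly p (x + y) = poly p x + poly p y) \<and>
     (\<forall>c x. poly p (fls_const c * x) = fls_const c * poly p x)"

lemma polys_below_0: "polys_below 0 = {0}"
  by (auto simp: polys_below_def poly_eq_iff)

lemma zero_in_polys_below [simp]: "0 \<in> polys_below d"
  by (simp add: polys_below_def)

lemma mem_polys_below_Suc_iff:
  "a \<in> polys_below (Suc d) \<longleftrightarrow> a - monom (coeff a d) d \<in> polys_below d" for a :: "'a::field poly"
proof -
  have "(\<forall>i\<ge>Suc d. coeff a i = 0) \<longleftrightarrow> (\<forall>i\<ge>d. i = d \<or> coeff a i = 0)"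
    by (metis Suc_le_eq le_less less_irrefl)
  thus ?thesis by (auto simp: polys_below_def)
qed

lemma bij_betw_polys_below_Suc:
  "bij_betw (\<lambda>(c, a). a + monom c d) (UNIV \<times> polys_below d) (polys_below (Suc d) :: 'a::field poly set)"
  by (rule bij_betwI[where g = "\<lambda>a. (coeff a d, a - monom (coeff a d) d)"])
     (auto simp: mem_polys_below_Suc_iff, auto simp: polys_below_def)

lemma card_polys_below: "card (polys_below d :: 'a::{field,finite} poly set) = CARD('a) ^ d"
proof (induction d)
  case (Suc d)
  thus ?case
    using bij_betw_same_card[OF bij_betw_polys_below_Suc[of d, where ?'a = 'a]]
    by (simp add: card_cartesian_product)
qed (simp add: polys_below_0)

lemma finite_polys_below [simp]: "finite (polys_below d :: 'a::{field,finite} poly set)"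
  by (rule card_ge_0_finite) (use card_gt_0[where ?'a = 'a] in \<open>auto simp: card_polys_below\<close>)

lemma polys_below_SucE:
  fixes a :: "'a::field poly"
  assumes "a \<in> polys_below (Suc d)"
  obtains c b where "b \<in> polys_below d" "a = b + smult c (monom 1 d)"
proof -
  have "a - monom (coeff a d) d \<in> polys_below d"
    using assms by (simp add: mem_polys_below_Suc_iff)
  from that[OF this, of "coeff a d"] show ?thesis by (simp add: smult_monom)
qed

lemma Fq_linear_0: "Fq_linear l \<Longrightarrow> l 0 = 0"
  unfolding Fq_linear_def by (metis add_cancel_right_left)

lemma linear_poly_0: "linear_poly p \<Longrightarrow> poly p 0 = 0"
  unfolding linear_poly_def by (metis add_cancel_right_left)

text \<open>The classical recursion for the polynomial vanishing on a finite F_q-space: passing from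
  \<open>p\<close> to p^q - y^(q-1) p, with \<open>y\<close> the value of \<open>p\<close> at the
  new basis vector, keeps linearity and the old roots, kills the new vector and multiplies the
  degree by q.\<close>

lemma vanishing_linear_poly:
  fixes \<beta> :: "'a::{field,finite} poly \<Rightarrow> 'a fls"
  assumes "Fq_linear \<beta>"
  shows "\<exists>p. degree p = CARD('a) ^ d \<and> linear_poly p \<and> (\<forall>a\<in>polys_below d. poly p (\<beta> a) = 0)"
proof (induction d)
  case 0
  show ?case
    by (rule exI[of _ "[:0, 1:]"])
       (use Fq_linear_0[OF assms] in \<open>auto simp: linear_poly_def polys_below_0\<close>)
next
  case (Suc d)
  let ?q = "CARD('a)"
  from Suc obtain p where p: "degree p = ?q ^ d" "linear_poly p" "\<forall>a\<in>polys_below d. poly p (\<beta> a) = 0"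
    by blast
  define y where "y = poly p (\<beta> (monom 1 d))"
  define r where "r = p ^ ?q + smult (- (y ^ (?q - 1))) p"
  have r: "poly r x = poly p x ^ ?q - y ^ (?q - 1) * poly p x" for x
    by (simp add: r_def)
  have lt: "?q ^ d < ?q ^ d * ?q" using card_ge_2[where ?'a = 'a] by simp
  have deg: "degree (p ^ ?q) = ?q ^ d * ?q"
  proof (subst degree_power_eq)
    show "p \<noteq> 0" using p(1) card_gt_0[where ?'a = 'a] by auto
  qed (simp add: p(1))
  have "degree r = ?q ^ Suc d"
    unfolding r_def
    by (subst degree_add_eq_left) (use deg lt p(1) in \<open>auto simp: mult.commute intro: le_less_trans[OF degree_smult_le]\<close>)
  moreover have lin: "linear_poly r"
    using p(2) fls_const_frobenius[of _ 1] frobenius_add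
    by (auto simp: linear_poly_def r algebra_simps power_mult_distrib)
  moreover have "poly r (\<beta> a) = 0" if "a \<in> polys_below (Suc d)" for a
  proof -
    from that obtain c b where b: "b \<in> polys_below d" "a = b + smult c (monom 1 d)"
      by (rule polys_below_SucE)
    have 1: "poly r (\<beta> b) = 0" using p(3) b(1) card_gt_0[where ?'a = 'a] by (simp add: r power_0_left)
    have 2: "poly r (\<beta> (monom 1 d)) = 0"
      using power_minus_mult[OF card_gt_0[where ?'a = 'a], of y] by (simp add: r flip: y_def)
    have "\<beta> a = \<beta> b + fls_const c * \<beta> (monom 1 d)"
      using assms b(2) by (simp add: Fq_linear_def)
    thus ?thesis using lin 1 2 by (simp add: linear_poly_def)
  qed
  ultimately show ?case by blast
qed

text \<open>Newton interpolation one basis vector at a time: the vanishing polynomial of the smaller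
  space corrects the value at the new vector without disturbing the others. The bound is multiplied
  by q to say q^(d-1) without subtraction; for \<open>d = 0\<close> it still forces degree
  0.\<close>

lemma interpolating_linear_poly:
  fixes \<beta> l :: "'a::{field,finite} poly \<Rightarrow> 'a fls"
  assumes \<beta>: "Fq_linear \<beta>" "inj \<beta>" and l: "Fq_linear l"
  shows "\<exists>h. degree h * CARD('a) \<le> CARD('a) ^ d \<and> linear_poly h \<and> (\<forall>a\<in>polys_below d. poly h (\<beta> a) = l a)"
proof (induction d)
  case 0
  show ?case
    by (rule exI[of _ 0])
       (use Fq_linear_0[OF l] in \<open>auto simp: linear_poly_def polys_below_0\<close>)
next
  case (Suc d)
  let ?q = "CARD('a)"
  from Suc obtain h where h: "degree h * ?q \<le> ?q ^ d" "linear_poly h" "\<forall>a\<in>polys_below d. poly h (\<beta> a) = l a"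
    by blast
  obtain p where p: "degree p = ?q ^ d" "linear_poly p" "\<forall>a\<in>polys_below d. poly p (\<beta> a) = 0"
    using vanishing_linear_poly[OF \<beta>(1)] by blast
  let ?t = "\<beta> (monom 1 d)"
  \<comment> \<open>Otherwise \<open>p\<close>, of degree q^d, would have q^d + 1 distinct
    roots.\<close>
  have nz: "poly p ?t \<noteq> 0"
  proof
    assume *: "poly p ?t = 0"
    have "p \<noteq> 0" using p(1) card_gt_0[where ?'a = 'a] by auto
    have notin: "monom 1 d \<notin> (polys_below d :: 'a poly set)" by (auto simp: polys_below_def)
    have "card (\<beta> ` insert (monom 1 d) (polys_below d)) \<le> card {x. poly p x = 0}"
      using p(3) * poly_roots_finite[OF \<open>p \<noteq> 0\<close>] by (intro card_mono) auto
    also have "\<dots> \<le> ?q ^ d" using card_poly_roots_bound[OF \<open>p \<noteq> 0\<close>] p(1) by simp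
    finally show False
      using notin by (subst (asm) card_image)
        (auto simp: card_polys_below inj_on_subset[OF \<beta>(2)] dest: injD[OF \<beta>(2)])
  qed
  define g where "g = (l (monom 1 d) - poly h ?t) / poly p ?t"
  define r where "r = h + smult g p"
  have "degree r \<le> ?q ^ d"
    unfolding r_def
  proof (rule degree_add_le)
    show "degree h \<le> ?q ^ d" using h(1) card_gt_0[where ?'a = 'a]
      by (intro order_trans[OF _ h(1)]) simp
  qed (use p(1) in \<open>auto intro: order_trans[OF degree_smult_le]\<close>)
  hence "degree r * ?q \<le> ?q ^ Suc d" by simp
  moreover have lin: "linear_poly r"
    using h(2) p(2) by (simp add: r_def linear_poly_def algebra_simps)
  moreover have "poly r (\<beta> a) = l a" if "a \<in> polys_below (Suc d)" for a
  proof -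
    from that obtain c b where b: "b \<in> polys_below d" "a = b + smult c (monom 1 d)"
      by (rule polys_below_SucE)
    have 1: "poly r (\<beta> b) = l b" using p(3) h(3) b(1) by (simp add: r_def)
    have 2: "poly r ?t = l (monom 1 d)"
      using nz by (simp add: r_def g_def)
    have "\<beta> a = \<beta> b + fls_const c * ?t" "l a = l b + fls_const c * l (monom 1 d)"
      using \<beta>(1) l b(2) by (simp_all add: Fq_linear_def)
    thus ?thesis using lin 1 2 by (simp add: linear_poly_def)
  qed
  ultimately show ?case by blast
qed

text \<open>Compare the top coefficients in Lagrange interpolation at the points of \<open>V\<close>.\<close>
lemma sum_poly_eq_coeff:
  fixes G :: "'k::field poly"
  assumes fin: "finite V" and deg: "degree G < card V"
    and \<kappa>: "\<And>v. v \<in> V \<Longrightarrow> (\<Prod>w\<in>V-{v}. v - w) = \<kappa>"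
  shows "(\<Sum>v\<in>V. poly G v) = \<kappa> * coeff G (card V - 1)"
proof -
  define P where "P = (\<lambda>v. \<Prod>w\<in>V-{v}. [:-w, 1:])"
  define L where "L = (\<Sum>v\<in>V. smult (poly G v) (P v))"
  have degP: "degree (P v) = card V - 1" "lead_coeff (P v) = 1" if "v \<in> V" for v
    unfolding P_def using that fin
    by (subst degree_prod_eq_sum_degree, auto simp: lead_coeff_prod)
  have polyP: "poly (P v) w = (if v = w then \<kappa> else 0)" if "v \<in> V" "w \<in> V" for v w
  proof (cases "v = w")
    case True
    thus ?thesis using \<kappa>[OF that(1)] by (simp add: P_def poly_prod)
  next
    case False
    thus ?thesis using that fin by (auto simp: P_def poly_prod intro!: prod_zero)
  qed
  have "smult \<kappa> G = L"
  proof (rule poly_eqI_degree[of V])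
    fix x assume "x \<in> V"
    have "poly L x = (\<Sum>v\<in>V. if v = x then poly G v * \<kappa> else 0)"
      unfolding L_def poly_sum using \<open>x \<in> V\<close> by (intro sum.cong) (auto simp: polyP)
    thus "poly (smult \<kappa> G) x = poly L x" using \<open>x \<in> V\<close> fin by simp
  next
    show "card V > degree (smult \<kappa> G)" using deg degree_smult_le[of \<kappa> G] by linarith
    have "degree L \<le> card V - 1" unfolding L_def
      by (intro degree_sum_le fin order_trans[OF degree_smult_le]) (simp add: degP)
    thus "card V > degree L" using deg by linarith
  qed
  hence "\<kappa> * coeff G (card V - 1) = coeff L (card V - 1)"
    by (metis coeff_smult)
  also have "\<dots> = (\<Sum>v\<in>V. poly G v)"
    unfolding L_def coeff_sum by (intro sum.cong refl) (use degP in \<open>auto\<close>)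
  finally show ?thesis by simp
qed

text \<open>The points form an additive group, so w -> v - w carries the points other than
  \<open>v\<close> to the nonzero points. The product of differences is therefore the same at every
  point, as Lagrange interpolation requires here.\<close>

lemma sum_polys_below_poly:
  fixes \<beta> :: "'a::{field,finite} poly \<Rightarrow> 'a fls"
  assumes \<beta>: "Fq_linear \<beta>" "inj \<beta>"
  shows "\<exists>\<kappa>. \<kappa> \<noteq> 0 \<and> (\<forall>G. degree G < CARD('a) ^ d \<longrightarrow>
           (\<Sum>a\<in>polys_below d. poly G (\<beta> a)) = \<kappa> * coeff G (CARD('a) ^ d - 1))"
proof -
  let ?W = "polys_below d :: 'a poly set"
  let ?\<kappa> = "\<Prod>u\<in>\<beta> ` ?W - {0}. u"
  have add: "\<beta> (a + b) = \<beta> a + \<beta> b" for a b using \<beta>(1) by (simp add: Fq_linear_def)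
  have diff: "\<beta> (a - b) = \<beta> a - \<beta> b" for a b using add[of "a - b" b] by simp
  have closed: "x - y \<in> \<beta> ` ?W" if "x \<in> \<beta> ` ?W" "y \<in> \<beta> ` ?W" for x y
  proof -
    from that obtain a b where "a \<in> ?W" "b \<in> ?W" "x = \<beta> a" "y = \<beta> b" by auto
    hence "x - y = \<beta> (a - b)" "a - b \<in> ?W" by (auto simp: diff polys_below_def)
    thus ?thesis by blast
  qed
  have \<kappa>: "(\<Prod>w\<in>\<beta> ` ?W - {v}. v - w) = ?\<kappa>" if "v \<in> \<beta> ` ?W" for v
    by (rule prod.reindex_bij_witness[of _ "\<lambda>u. v - u" "\<lambda>w. v - w"]) (use that closed in auto)
  have inj: "inj_on \<beta> ?W" using \<beta>(2) by (rule inj_on_subset) simp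
  have card: "card (\<beta> ` ?W) = CARD('a) ^ d" by (simp add: card_image[OF inj] card_polys_below)
  have "(\<Sum>a\<in>?W. poly G (\<beta> a)) = ?\<kappa> * coeff G (CARD('a) ^ d - 1)" if "degree G < CARD('a) ^ d" for G
    using sum_poly_eq_coeff[of "\<beta> ` ?W" G ?\<kappa>] that \<kappa> card by (simp add: sum.reindex[OF inj])
  thus ?thesis by (intro exI[of _ ?\<kappa>]) auto
qed

section \<open>Sums over monic polynomials\<close>

lemma A_monic_eq: "A_monic d = {a :: 'a::field poly. a \<in> polys_below (Suc d) \<and> coeff a d = 1}"
proof (intro set_eqI iffI; clarsimp simp: A_monic_def polys_below_def)
  fix a :: "'a poly" assume *: "\<forall>i\<ge>Suc d. coeff a i = 0" "coeff a d = 1"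
  have "degree a = d"
    using * by (intro antisym degree_le le_degree) auto
  thus "lead_coeff a = 1 \<and> degree a = d" using * by simp
qed (auto intro: coeff_eq_0)

lemma finite_A_monic [simp]: "finite (A_monic d :: 'a::{field,finite} poly set)"
  by (rule finite_subset[OF _ finite_polys_below[of "Suc d"]]) (auto simp: A_monic_eq)

text \<open>Every nonzero polynomial is a scalar times a monic one, and the number q - 1 of scalars
  equals -1 in the field. This passes from the linear space, where interpolation works, to monic
  polynomials.\<close>

lemma sum_polys_below_homogeneous:
  fixes f :: "'a::{field,finite} poly \<Rightarrow> 'a fls"
  assumes f: "\<And>c a. c \<noteq> 0 \<Longrightarrow> f (smult c a) = f a"
  shows "(\<Sum>a\<in>polys_below d - {0}. f a) = - (\<Sum>j<d. \<Sum>a\<in>A_monic j. f a)"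
proof (induction d)
  case (Suc d)
  let ?B = "{a::'a poly. a \<in> polys_below (Suc d) \<and> coeff a d \<noteq> 0}"
  have un: "polys_below (Suc d) - {0} = (polys_below d - {0}) \<union> ?B"
  proof -
    have "a \<in> polys_below (Suc d) \<longleftrightarrow> a \<in> polys_below d" if "coeff a d = 0" for a :: "'a poly"
      using that by (simp add: mem_polys_below_Suc_iff)
    moreover have "coeff a d = 0" if "a \<in> polys_below d" for a :: "'a poly"
      using that by (simp add: polys_below_def)
    ultimately show ?thesis by (auto simp: polys_below_def)
  qed
  have fin: "finite ?B" by (rule finite_subset[OF _ finite_polys_below[of "Suc d"]]) auto
  have "(\<Sum>a\<in>?B. f a) = (\<Sum>(c,a)\<in>(UNIV - {0::'a}) \<times> A_monic d. f a)"
    by (rule sum.reindex_bij_witness[of _ "\<lambda>(c,a). smult c a" "\<lambda>a. (coeff a d, smult (inverse (coeff a d)) a)"])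
       (auto simp: A_monic_eq f polys_below_def)
  also have "\<dots> = of_nat (CARD('a) - 1) * (\<Sum>a\<in>A_monic d. f a)"
    by (simp add: sum.cartesian_product[symmetric])
  also have "of_nat (CARD('a) - 1) = (-1 :: 'a fls)"
    using card_gt_0[where ?'a = 'a] by (simp add: of_nat_diff Suc_leI of_nat_card_fls)
  finally have "(\<Sum>a\<in>?B. f a) = - (\<Sum>a\<in>A_monic d. f a)" by simp
  moreover have "(polys_below d - {0}) \<inter> ?B = {}" by (auto simp: polys_below_def)
  ultimately show ?case using Suc
    by (simp add: un sum.union_disjoint fin)
qed (simp add: polys_below_0)

lemma poly_prod_list: "poly (prod_list ps) x = prod_list (map (\<lambda>p. poly p x) ps)"
  by (induction ps) auto

lemma degree_prod_list_le:
  "(\<And>p. p \<in> set ps \<Longrightarrow> degree p \<le> m) \<Longrightarrow> degree (prod_list ps) \<le> length ps * m"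
proof (induction ps)
  case (Cons p ps)
  have "degree (p * prod_list ps) \<le> degree p + degree (prod_list ps)" by (rule degree_mult_le)
  also have "\<dots> \<le> m + length ps * m" using Cons by (intro add_mono) auto
  finally show ?case by simp
qed auto

lemma coeff_mult_top:
  fixes p r :: "'a::comm_ring_1 poly"
  assumes "degree p \<le> m" "degree r \<le> n"
  shows "coeff (p * r) (m + n) = coeff p m * coeff r n"
proof -
  have "coeff (p * r) (m + n) = (\<Sum>i\<le>m+n. if i = m then coeff p m * coeff r n else 0)"
    unfolding coeff_mult
  proof (intro sum.cong refl)
    fix i
    show "coeff p i * coeff r (m + n - i) = (if i = m then coeff p m * coeff r n else 0)"
    proof (cases i m rule: linorder_cases)
      case less
      hence "coeff r (m + n - i) = 0" using assms by (intro coeff_eq_0) linarith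
      thus ?thesis using less by simp
    next
      case greater
      hence "coeff p i = 0" using assms by (intro coeff_eq_0) linarith
      thus ?thesis using greater by simp
    qed simp
  qed
  thus ?thesis by simp
qed

lemma coeff_prod_list_top:
  fixes ps :: "'a::comm_ring_1 poly list"
  shows "(\<And>p. p \<in> set ps \<Longrightarrow> degree p \<le> m) \<Longrightarrow>
    coeff (prod_list ps) (length ps * m) = prod_list (map (\<lambda>p. coeff p m) ps)"
proof (induction ps)
  case (Cons p ps)
  have "coeff (p * prod_list ps) (m + length ps * m) = coeff p m * coeff (prod_list ps) (length ps * m)"
    using Cons.prems by (intro coeff_mult_top degree_prod_list_le) auto
  thus ?case using Cons by simp
qed auto

text \<open>A linear polynomial has no constant term, so it can be divided by the variable; the
  interpolant of degree at most q^d yields a quotient of degree at most q^d - 1.\<close>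

lemma quotient_interpolation:
  fixes \<beta> l :: "'a::{field,finite} poly \<Rightarrow> 'a fls"
  assumes \<beta>: "Fq_linear \<beta>" "inj \<beta>" and l: "Fq_linear l"
  shows "\<exists>g. degree g \<le> CARD('a) ^ d - 1 \<and> (\<forall>a\<in>polys_below (Suc d) - {0}. poly g (\<beta> a) = l a / \<beta> a)"
proof -
  obtain h where h: "degree h * CARD('a) \<le> CARD('a) ^ Suc d" "linear_poly h"
     "\<forall>a\<in>polys_below (Suc d). poly h (\<beta> a) = l a"
    using interpolating_linear_poly[OF assms] by blast
  obtain c g where cg: "h = pCons c g" by (rule pCons_cases)
  have "c = 0" using linear_poly_0[OF h(2)] cg by simp
  have "degree h \<le> CARD('a) ^ d" using h(1) card_gt_0[where ?'a = 'a] by simp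
  hence "degree g \<le> CARD('a) ^ d - 1" unfolding cg by (auto simp: degree_pCons_eq_if split: if_splits)
  moreover have "poly g (\<beta> a) = l a / \<beta> a" if "a \<in> polys_below (Suc d) - {0}" for a
  proof -
    have "\<beta> a \<noteq> 0" using that \<beta> Fq_linear_0[OF \<beta>(1)] by (metis DiffD2 injD singletonI)
    moreover have "l a = \<beta> a * poly g (\<beta> a)" using h(3) that \<open>c = 0\<close> by (auto simp: cg)
    ultimately show ?thesis by simp
  qed
  ultimately show ?thesis by blast
qed

lemma Fq_linear_smult: "Fq_linear l \<Longrightarrow> l (smult c a) = fls_const c * l a"
  by (simp add: Fq_linear_def)

lemma prod_list_map_divide:
  fixes f :: "'b \<Rightarrow> 'k::field"
  shows "prod_list (map (\<lambda>x. f x / y) xs) = prod_list (map f xs) / y ^ length xs"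
  by (induction xs) (auto simp: field_simps)

lemma prod_list_map_const_mult:
  fixes f :: "'b \<Rightarrow> 'k::comm_semiring_1"
  shows "prod_list (map (\<lambda>x. y * f x) xs) = y ^ length xs * prod_list (map f xs)"
  by (induction xs) (auto simp: mult_ac)

text \<open>The product of the interpolants has degree below q^(d+1) - 1, so its sum over all points
  vanishes and the nonzero points contribute minus its value at 0, which is multiplicative in the
  factors.\<close>

lemma sum_polys_below_prod:
  fixes \<beta> :: "'a::{field,finite} poly \<Rightarrow> 'a fls"
  assumes \<beta>: "Fq_linear \<beta>" "inj \<beta>"
    and ls: "\<And>l. l \<in> set ls \<Longrightarrow> Fq_linear l" "length ls \<le> CARD('a)"
  shows "(\<Sum>a\<in>polys_below (Suc d) - {0}. prod_list (map (\<lambda>l. l a / \<beta> a) ls)) =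
         - prod_list (map (\<lambda>l. - (\<Sum>a\<in>polys_below (Suc d) - {0}. l a / \<beta> a)) ls)"
proof -
  let ?q = "CARD('a)" and ?W = "polys_below (Suc d) :: 'a poly set"
  obtain g where g: "degree (g l) \<le> ?q ^ d - 1" "\<forall>a\<in>?W - {0}. poly (g l) (\<beta> a) = l a / \<beta> a"
    if "Fq_linear l" for l
    using quotient_interpolation[OF \<beta>, of _ d] by metis
  obtain \<kappa> where \<kappa>: "\<And>G. degree G < ?q ^ Suc d \<Longrightarrow>
      (\<Sum>a\<in>?W. poly G (\<beta> a)) = \<kappa> * coeff G (?q ^ Suc d - 1)"
    using sum_polys_below_poly[OF \<beta>, of "Suc d"] by blast
  have *: "(\<Sum>a\<in>?W - {0}. prod_list (map (\<lambda>l. l a / \<beta> a) ms)) = - prod_list (map (\<lambda>l. poly (g l) 0) ms)"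
    if ms: "\<And>l. l \<in> set ms \<Longrightarrow> Fq_linear l" "length ms \<le> ?q" for ms
  proof -
    define G where "G = prod_list (map g ms)"
    have "degree G \<le> length (map g ms) * (?q ^ d - 1)"
      unfolding G_def by (rule degree_prod_list_le) (use ms g in auto)
    also have "\<dots> \<le> ?q * (?q ^ d - 1)" using ms by simp
    also have "\<dots> < ?q ^ Suc d - 1"
    proof -
      have "?q * 1 \<le> ?q * ?q ^ d" using card_gt_0[where ?'a = 'a] by (intro mult_le_mono2) simp
      thus ?thesis using card_ge_2[where ?'a = 'a] unfolding diff_mult_distrib2 power_Suc by linarith
    qed
    finally have deg: "degree G < ?q ^ Suc d - 1" .
    hence "(\<Sum>a\<in>?W. poly G (\<beta> a)) = 0" using \<kappa>[of G] by (simp add: coeff_eq_0)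
    hence "(\<Sum>a\<in>?W - {0}. poly G (\<beta> a)) = - poly G 0"
      by (simp add: sum_diff1 Fq_linear_0[OF \<beta>(1)])
    moreover have "poly G (\<beta> a) = prod_list (map (\<lambda>l. l a / \<beta> a) ms)" if "a \<in> ?W - {0}" for a
      unfolding G_def poly_prod_list map_map o_def
      by (intro arg_cong[of _ _ prod_list] map_cong refl) (use that g(2) ms(1) in auto)
    ultimately show ?thesis by (simp add: G_def poly_prod_list o_def)
  qed
  \<comment> \<open>The one-factor case identifies the value at 0 of each interpolant.\<close>
  have **: "poly (g l) 0 = - (\<Sum>a\<in>?W - {0}. l a / \<beta> a)" if "Fq_linear l" for l
    using *[of "[l]"] that card_gt_0[where ?'a = 'a] by simp
  have "map (\<lambda>l. poly (g l) 0) ls = map (\<lambda>l. - (\<Sum>a\<in>?W - {0}. l a / \<beta> a)) ls"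
    using ls(1) ** by auto
  thus ?thesis by (simp only: *[OF ls])
qed

theorem sum_monic_below_prod:
  fixes \<beta> :: "'a::{field,finite} poly \<Rightarrow> 'a fls"
  assumes \<beta>: "Fq_linear \<beta>" "inj \<beta>"
    and ls: "\<And>l. l \<in> set ls \<Longrightarrow> Fq_linear l" "length ls \<le> CARD('a)"
  shows "(\<Sum>j<Suc d. \<Sum>a\<in>A_monic j. prod_list (map (\<lambda>l. l a) ls) / \<beta> a ^ length ls) =
         prod_list (map (\<lambda>l. \<Sum>j<Suc d. \<Sum>a\<in>A_monic j. l a / \<beta> a) ls)"
proof -
  \<comment> \<open>There are as many forms as factors \<open>\<beta>\<close>, so scalars cancel and
    the monic polynomials determine the sum.\<close>
  have hom: "prod_list (map (\<lambda>l. l (smult c a) / \<beta> (smult c a)) ms) = prod_list (map (\<lambda>l. l a / \<beta> a) ms)"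
    if "c \<noteq> 0" "\<And>l. l \<in> set ms \<Longrightarrow> Fq_linear l" for c a ms
    by (intro arg_cong[of _ _ prod_list] map_cong refl)
       (use that in \<open>simp add: Fq_linear_smult[OF \<beta>(1)] Fq_linear_smult[OF that(2)]\<close>)
  have "- (\<Sum>a\<in>polys_below (Suc d) - {0}. l a / \<beta> a) = (\<Sum>j<Suc d. \<Sum>a\<in>A_monic j. l a / \<beta> a)"
    if "l \<in> set ls" for l
  proof -
    have "(\<Sum>a\<in>polys_below (Suc d) - {0}. l a / \<beta> a) = - (\<Sum>j<Suc d. \<Sum>a\<in>A_monic j. l a / \<beta> a)"
      using hom[of _ "[l]"] ls(1)[OF that] by (intro sum_polys_below_homogeneous) simp
    thus ?thesis by simp
  qed
  hence "prod_list (map (\<lambda>l. - (\<Sum>a\<in>polys_below (Suc d) - {0}. l a / \<beta> a)) ls) =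
      prod_list (map (\<lambda>l. \<Sum>j<Suc d. \<Sum>a\<in>A_monic j. l a / \<beta> a) ls)"
    by (intro arg_cong[of _ _ prod_list] map_cong refl) auto
  moreover have "(\<Sum>a\<in>polys_below (Suc d) - {0}. prod_list (map (\<lambda>l. l a / \<beta> a) ls)) =
      - (\<Sum>j<Suc d. \<Sum>a\<in>A_monic j. prod_list (map (\<lambda>l. l a / \<beta> a) ls))"
    using hom ls(1) by (intro sum_polys_below_homogeneous) blast
  ultimately have "(\<Sum>j<Suc d. \<Sum>a\<in>A_monic j. prod_list (map (\<lambda>l. l a / \<beta> a) ls)) =
      prod_list (map (\<lambda>l. \<Sum>j<Suc d. \<Sum>a\<in>A_monic j. l a / \<beta> a) ls)"
    using sum_polys_below_prod[OF assms, of d] by (simp only: neg_equal_iff_equal)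
  thus ?thesis by (simp only: prod_list_map_divide)
qed

lemma Fq_linear_coeff: "Fq_linear (\<lambda>a. fls_const (coeff a d))"
  by (auto simp: Fq_linear_def fls_plus_const fls_const_mult_const)

text \<open>
  The factor \<open>coeff a d\<close> discards the polynomials of degree below \<open>d\<close>, so this is a special case
  of the previous theorem.
\<close>
theorem sum_monic_prod_power:
  fixes \<beta> :: "'a::{field,finite} poly \<Rightarrow> 'a fls"
  assumes \<beta>: "Fq_linear \<beta>" "inj \<beta>"
    and ls: "\<And>l. l \<in> set ls \<Longrightarrow> Fq_linear l" and r: "length ls < r" "r \<le> CARD('a)"
  shows "(\<Sum>a\<in>A_monic d. prod_list (map (\<lambda>l. l a) ls) / \<beta> a ^ r) =
         (\<Sum>a\<in>A_monic d. 1 / \<beta> a) ^ (r - length ls) *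
         prod_list (map (\<lambda>l. \<Sum>j<Suc d. \<Sum>a\<in>A_monic j. l a / \<beta> a) ls)"
proof -
  let ?\<delta> = "\<lambda>a::'a poly. fls_const (coeff a d)"
  let ?ls = "replicate (r - length ls) ?\<delta> @ ls"
  have len: "length ?ls = r" using r by simp
  have 0: "coeff a d = 0" if "a \<in> A_monic j" "j < d" for a :: "'a poly" and j
    using that by (auto simp: A_monic_def coeff_eq_0)
  have 1: "coeff a d = 1" if "a \<in> A_monic d" for a :: "'a poly"
    using that by (auto simp: A_monic_def)
  have collapse: "(\<Sum>j<Suc d. \<Sum>a\<in>A_monic j. ?\<delta> a ^ (r - length ls) * f a) = (\<Sum>a\<in>A_monic d. f a)"
    for f :: "'a poly \<Rightarrow> 'a fls"
    using 0 1 r by (simp add: power_0_left)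
  have collapse1: "(\<Sum>j<Suc d. \<Sum>a\<in>A_monic j. ?\<delta> a / \<beta> a) = (\<Sum>a\<in>A_monic d. 1 / \<beta> a)"
    using 0 1 by simp
  have "(\<Sum>j<Suc d. \<Sum>a\<in>A_monic j. prod_list (map (\<lambda>l. l a) ?ls) / \<beta> a ^ length ?ls) =
         prod_list (map (\<lambda>l. \<Sum>j<Suc d. \<Sum>a\<in>A_monic j. l a / \<beta> a) ?ls)"
    using ls r Fq_linear_coeff[of d] by (intro sum_monic_below_prod \<beta>) (auto split: if_splits)
  also have "(\<Sum>j<Suc d. \<Sum>a\<in>A_monic j. prod_list (map (\<lambda>l. l a) ?ls) / \<beta> a ^ length ?ls) =
      (\<Sum>a\<in>A_monic d. prod_list (map (\<lambda>l. l a) ls) / \<beta> a ^ r)"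
    unfolding len using collapse[of "\<lambda>a. prod_list (map (\<lambda>l. l a) ls) / \<beta> a ^ r"]
    by (simp add: prod_list_replicate)
  finally show ?thesis by (simp only: map_append map_replicate prod_list.append prod_list_replicate collapse1)
qed

text \<open>\<open>T l\<close> is the coefficient at q^d - 1 of the interpolant of
  l/\<open>\<beta>\<close>, \<open>t\<close> is its value at the form \<open>coeff a d\<close>, and
  \<open>K\<close> is minus the constant of \<open>sum_polys_below_poly\<close>. The list is padded
  to q forms by copies of \<open>coeff a d\<close>, which also restrict the sum to degree
  \<open>d\<close>. Multiplying the q interpolants by X^(q-1) makes the admissible degree exactly
  q^(d+1) - 1, so the sum is a product of top coefficients.\<close>

lemma sum_monic_prod_top_coeff:
  fixes \<beta> :: "'a::{field,finite} poly \<Rightarrow> 'a fls"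
  assumes \<beta>: "Fq_linear \<beta>" "inj \<beta>"
  shows "\<exists>K T t. K \<noteq> 0 \<and> t \<noteq> 0 \<and> (\<forall>i<d. T (\<lambda>a. \<beta> a ^ (CARD('a) ^ i)) = 0) \<and>
    (\<forall>ls. (\<forall>l\<in>set ls. Fq_linear l) \<and> length ls < CARD('a) \<longrightarrow>
      (\<Sum>a\<in>A_monic d. prod_list (map (\<lambda>l. l a) ls) / \<beta> a) =
      K * t ^ (CARD('a) - length ls) * prod_list (map T ls))"
proof -
  let ?q = "CARD('a)" and ?W = "polys_below (Suc d) :: 'a poly set"
  let ?\<delta> = "\<lambda>a::'a poly. fls_const (coeff a d)"
  note q2 = card_ge_2[where ?'a = 'a]
  have \<beta>nz: "\<beta> a \<noteq> 0" if "a \<noteq> 0" for a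
    using that \<beta> Fq_linear_0[OF \<beta>(1)] by (metis injD)
  \<comment> \<open>The last clause fixes the interpolant of the q^i-th power of
    \<open>\<beta>\<close> to be X^(q^i - 1), whose degree is too small to reach the coefficient at
    q^d - 1.\<close>
  define Q where "Q = (\<lambda>l g. Fq_linear l \<longrightarrow> degree g \<le> ?q ^ d - 1 \<and>
     (\<forall>a\<in>?W - {0}. poly g (\<beta> a) = l a / \<beta> a) \<and>
     (\<forall>i<d. l = (\<lambda>a. \<beta> a ^ (?q ^ i)) \<longrightarrow> coeff g (?q ^ d - 1) = 0))"
  have "\<exists>g. Q l g" for l
  proof (cases "\<exists>i<d. l = (\<lambda>a. \<beta> a ^ (?q ^ i))")
    case True
    then obtain i where i: "i < d" "l = (\<lambda>a. \<beta> a ^ (?q ^ i))" by blast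
    have lt: "?q ^ i < ?q ^ d" using i q2 by (intro power_strict_increasing) auto
    have pos: "?q ^ i > 0" using q2 by simp
    have eq: "x ^ (?q ^ i - 1) = x ^ (?q ^ i) / x" if "x \<noteq> 0" for x :: "'a fls"
      using power_minus_mult[OF pos, of x] that by (simp add: field_simps)
    have "?q ^ i - 1 < ?q ^ d - 1" using lt pos by linarith
    hence "degree (monom (1 :: 'a fls) (?q ^ i - 1)) \<le> ?q ^ d - 1" "coeff (monom (1 :: 'a fls) (?q ^ i - 1)) (?q ^ d - 1) = 0"
      by (auto simp: degree_monom_eq)
    moreover have "\<forall>a\<in>?W - {0}. poly (monom 1 (?q ^ i - 1)) (\<beta> a) = l a / \<beta> a"
      using eq \<beta>nz by (auto simp: poly_monom i)
    ultimately show ?thesis unfolding Q_def by blast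
  next
    case False
    thus ?thesis unfolding Q_def using quotient_interpolation[OF \<beta>, of l d] by blast
  qed
  then obtain g where "\<And>l. Q l (g l)" by metis
  hence g: "\<And>l. Fq_linear l \<Longrightarrow> degree (g l) \<le> ?q ^ d - 1"
     "\<And>l a. Fq_linear l \<Longrightarrow> a \<in> ?W - {0} \<Longrightarrow> poly (g l) (\<beta> a) = l a / \<beta> a"
     "\<And>l i. Fq_linear l \<Longrightarrow> i < d \<Longrightarrow> l = (\<lambda>a. \<beta> a ^ (?q ^ i)) \<Longrightarrow> coeff (g l) (?q ^ d - 1) = 0"
    unfolding Q_def by blast+
  define T where "T = (\<lambda>l. coeff (g l) (?q ^ d - 1))"
  have lin: "Fq_linear (\<lambda>a. \<beta> a ^ (?q ^ i))" for i
    using \<beta>(1) by (simp add: Fq_linear_def frobenius_pow_add power_mult_distrib fls_const_frobenius)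
  \<comment> \<open>The interpolant of \<open>?\<delta>\<close> vanishes at the q^d - 1 nonzero
    points of degree below \<open>d\<close> but not at the monomial of degree \<open>d\<close>; a
    degree below q^d - 1 would be too small for that many roots.\<close>
  have T\<delta>: "T ?\<delta> \<noteq> 0"
  proof
    let ?g = "g ?\<delta>"
    assume 0: "T ?\<delta> = 0"
    have m: "monom 1 d \<in> ?W - {0}" by (auto simp: polys_below_def)
    have "poly ?g (\<beta> (monom 1 d)) \<noteq> 0"
      using g(2)[OF Fq_linear_coeff m] \<beta>nz[of "monom 1 d"] by simp
    hence nz: "?g \<noteq> 0" by auto
    have "degree ?g \<noteq> ?q ^ d - 1" using 0 nz unfolding T_def by (metis leading_coeff_0_iff)
    hence deg: "degree ?g < ?q ^ d - 1" using g(1)[OF Fq_linear_coeff[of d]] by simp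
    have "poly ?g (\<beta> a) = 0" if "a \<in> polys_below d - {0}" for a
    proof -
      have "a \<in> ?W - {0}" "coeff a d = 0" using that by (auto simp: polys_below_def)
      thus ?thesis using g(2)[OF Fq_linear_coeff] by simp
    qed
    hence "card (\<beta> ` (polys_below d - {0})) \<le> card {x. poly ?g x = 0}"
      using poly_roots_finite[OF nz] by (intro card_mono) auto
    also have "\<dots> \<le> degree ?g" by (rule card_poly_roots_bound[OF nz])
    finally show False using deg
      by (subst (asm) card_image) (auto simp: card_polys_below card_Diff_singleton inj_on_subset[OF \<beta>(2)])
  qed
  obtain \<kappa> where \<kappa>: "\<kappa> \<noteq> 0" "\<And>G. degree G < ?q ^ Suc d \<Longrightarrow>
      (\<Sum>a\<in>?W. poly G (\<beta> a)) = \<kappa> * coeff G (?q ^ Suc d - 1)"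
    using sum_polys_below_poly[OF \<beta>, of "Suc d"] by blast
  have main: "(\<Sum>a\<in>A_monic d. prod_list (map (\<lambda>l. l a) ls) / \<beta> a) =
      (-\<kappa>) * T ?\<delta> ^ (?q - length ls) * prod_list (map T ls)"
    if ls: "\<forall>l\<in>set ls. Fq_linear l" "length ls < ?q" for ls
  proof -
    define ms where "ms = replicate (?q - length ls) ?\<delta> @ ls"
    have ms: "\<And>l. l \<in> set ms \<Longrightarrow> Fq_linear l" "length ms = ?q"
      using ls Fq_linear_coeff[of d] by (auto simp: ms_def)
    define P where "P = prod_list (map g ms)"
    define G where "G = monom 1 (?q - 1) * P"
    have degP: "degree P \<le> ?q * (?q ^ d - 1)"
      unfolding P_def using degree_prod_list_le[of "map g ms" "?q ^ d - 1"] g(1) ms by auto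
    have top: "?q - 1 + ?q * (?q ^ d - 1) = ?q ^ Suc d - 1"
    proof -
      have "?q * 1 \<le> ?q * ?q ^ d" using card_gt_0[where ?'a = 'a] by (intro mult_le_mono2) simp
      thus ?thesis using q2 unfolding diff_mult_distrib2 power_Suc by linarith
    qed
    have "degree G \<le> ?q - 1 + ?q * (?q ^ d - 1)"
      unfolding G_def by (rule order_trans[OF degree_mult_le]) (use degP in \<open>simp add: degree_monom_eq\<close>)
    hence deg: "degree G < ?q ^ Suc d" unfolding top using q2
      by (metis Suc_pred' card_gt_0 le_imp_less_Suc zero_less_power)
    have "coeff G (?q ^ Suc d - 1) = coeff (monom (1::'a fls) (?q - 1)) (?q - 1) * coeff P (?q * (?q ^ d - 1))"
      unfolding G_def top[symmetric] by (rule coeff_mult_top) (use degP in \<open>auto simp: degree_monom_eq\<close>)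
    also have "coeff P (?q * (?q ^ d - 1)) = prod_list (map T ms)"
      unfolding P_def using coeff_prod_list_top[of "map g ms" "?q ^ d - 1"] g(1) ms by (auto simp: T_def o_def)
    finally have "(\<Sum>a\<in>?W. poly G (\<beta> a)) = \<kappa> * prod_list (map T ms)"
      using \<kappa>(2)[OF deg] by simp
    moreover have "poly G (\<beta> 0) = 0" using q2 by (simp add: G_def poly_monom Fq_linear_0[OF \<beta>(1)] power_0_left)
    ultimately have "(\<Sum>a\<in>?W - {0}. poly G (\<beta> a)) = \<kappa> * prod_list (map T ms)"
      by (simp add: sum_diff1)
    moreover have "poly G (\<beta> a) = prod_list (map (\<lambda>l. l a) ms) / \<beta> a" if "a \<in> ?W - {0}" for a
    proof -
      have "poly P (\<beta> a) = prod_list (map (\<lambda>l. l a / \<beta> a) ms)"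
        unfolding P_def poly_prod_list map_map o_def
        by (intro arg_cong[of _ _ prod_list] map_cong refl) (use that g(2) ms(1) in auto)
      moreover have "\<beta> a ^ (?q - 1) * (x / \<beta> a ^ ?q) = x / \<beta> a" for x
        using power_minus_mult[OF card_gt_0[where ?'a = 'a], of "\<beta> a"] \<beta>nz[of a] that
        by (simp add: field_simps)
      ultimately show ?thesis by (simp add: G_def poly_monom prod_list_map_divide ms(2))
    qed
    ultimately have eq: "(\<Sum>a\<in>?W - {0}. prod_list (map (\<lambda>l. l a) ms) / \<beta> a) = \<kappa> * prod_list (map T ms)"
      by simp
    \<comment> \<open>With q forms over a single \<open>\<beta>\<close> a scalar contributes c^q / c
      = 1.\<close>
    have hom: "prod_list (map (\<lambda>l. l (smult c a)) ms) / \<beta> (smult c a) = prod_list (map (\<lambda>l. l a) ms) / \<beta> a"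
      if "c \<noteq> 0" for c a
    proof -
      have "map (\<lambda>l. l (smult c a)) ms = map (\<lambda>l. fls_const c * l a) ms"
        by (intro map_cong refl Fq_linear_smult ms(1))
      hence "prod_list (map (\<lambda>l. l (smult c a)) ms) = fls_const c ^ ?q * prod_list (map (\<lambda>l. l a) ms)"
        by (simp only: prod_list_map_const_mult ms(2))
      thus ?thesis using \<beta>(1) that fls_const_frobenius[of c 1] by (simp add: Fq_linear_def)
    qed
    have 0: "coeff a d = 0" if "a \<in> A_monic j" "j < d" for a :: "'a poly" and j
      using that by (auto simp: A_monic_def coeff_eq_0)
    have 1: "coeff a d = 1" if "a \<in> A_monic d" for a :: "'a poly"
      using that by (auto simp: A_monic_def)
    have "(\<Sum>j<Suc d. \<Sum>a\<in>A_monic j. prod_list (map (\<lambda>l. l a) ms) / \<beta> a) =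
       (\<Sum>a\<in>A_monic d. prod_list (map (\<lambda>l. l a) ls) / \<beta> a)"
      using 0 1 ls by (simp add: ms_def prod_list_replicate power_0_left)
    hence "(\<Sum>a\<in>A_monic d. prod_list (map (\<lambda>l. l a) ls) / \<beta> a) = - \<kappa> * prod_list (map T ms)"
      using eq sum_polys_below_homogeneous[of "\<lambda>a. prod_list (map (\<lambda>l. l a) ms) / \<beta> a" "Suc d"] hom
      by (simp add: minus_equation_iff)
    thus ?thesis by (simp add: ms_def prod_list_replicate)
  qed
  show ?thesis
    by (rule exI[of _ "-\<kappa>"], rule exI[of _ T], rule exI[of _ "T ?\<delta>"])
       (use \<kappa>(1) T\<delta> main g(3)[OF lin] in \<open>auto simp: T_def\<close>)
qed

text \<open>The unknown constants of the previous lemma are eliminated: the empty list gives c = K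
  t^q, and a single form \<open>l\<close> gives c T(l)/t.\<close>

theorem sum_monic_prod:
  fixes \<beta> :: "'a::{field,finite} poly \<Rightarrow> 'a fls" and d :: nat
  assumes \<beta>: "Fq_linear \<beta>" "inj \<beta>"
    and ls: "\<And>l. l \<in> set ls \<Longrightarrow> Fq_linear l" "length ls < CARD('a)"
  defines "c \<equiv> \<Sum>a\<in>A_monic d. 1 / \<beta> a"
  shows "(\<Sum>a\<in>A_monic d. prod_list (map (\<lambda>l. l a) ls) / \<beta> a) =
         c * prod_list (map (\<lambda>l. (\<Sum>a\<in>A_monic d. l a / \<beta> a) / c) ls)"
    and "c \<noteq> 0"
    and "i < d \<Longrightarrow> (\<Sum>a\<in>A_monic d. \<beta> a ^ (CARD('a) ^ i) / \<beta> a) = 0"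
proof -
  let ?q = "CARD('a)"
  obtain K T t where KTt: "K \<noteq> 0 \<and> t \<noteq> 0 \<and> (\<forall>i<d. T (\<lambda>a. \<beta> a ^ (?q ^ i)) = 0) \<and>
    (\<forall>ls. (\<forall>l\<in>set ls. Fq_linear l) \<and> length ls < ?q \<longrightarrow>
      (\<Sum>a\<in>A_monic d. prod_list (map (\<lambda>l. l a) ls) / \<beta> a) = K * t ^ (?q - length ls) * prod_list (map T ls))"
    using sum_monic_prod_top_coeff[OF \<beta>, of d] by (elim exE) (rule that)
  have *: "K \<noteq> 0" "t \<noteq> 0" "\<And>i. i < d \<Longrightarrow> T (\<lambda>a. \<beta> a ^ (?q ^ i)) = 0"
    "\<And>ls. (\<forall>l\<in>set ls. Fq_linear l) \<Longrightarrow> length ls < ?q \<Longrightarrow>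
      (\<Sum>a\<in>A_monic d. prod_list (map (\<lambda>l. l a) ls) / \<beta> a) = K * t ^ (?q - length ls) * prod_list (map T ls)"
    using KTt by (elim conjE; simp)+
  have c: "c = K * t ^ ?q" using *(4)[of "[]"] card_gt_0[where ?'a = 'a] by (simp add: c_def)
  thus "c \<noteq> 0" using * by simp
  have 1: "(\<Sum>a\<in>A_monic d. l a / \<beta> a) = c * (T l / t)" if "Fq_linear l" for l
  proof -
    have "(\<Sum>a\<in>A_monic d. l a / \<beta> a) = K * t ^ (?q - 1) * T l"
      using *(4)[of "[l]"] that card_ge_2[where ?'a = 'a] by simp
    thus ?thesis using power_minus_mult[OF card_gt_0[where ?'a = 'a], of t] *(2)
      by (simp add: c field_simps)
  qed
  have "prod_list (map (\<lambda>l. (\<Sum>a\<in>A_monic d. l a / \<beta> a) / c) ls) = prod_list (map (\<lambda>l. T l / t) ls)"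
    by (intro arg_cong[of _ _ prod_list] map_cong refl) (use \<open>c \<noteq> 0\<close> 1 ls(1) in simp)
  also have "c * \<dots> = K * t ^ (?q - length ls) * prod_list (map T ls)"
    using *(2) ls(2) by (simp add: c prod_list_map_divide power_diff)
  finally show "(\<Sum>a\<in>A_monic d. prod_list (map (\<lambda>l. l a) ls) / \<beta> a) =
         c * prod_list (map (\<lambda>l. (\<Sum>a\<in>A_monic d. l a / \<beta> a) / c) ls)"
    using *(4)[of ls] ls by simp
  have lin: "Fq_linear (\<lambda>a. \<beta> a ^ (?q ^ i))" for i
    using \<beta>(1) by (simp add: Fq_linear_def frobenius_pow_add power_mult_distrib fls_const_frobenius)
  show "(\<Sum>a\<in>A_monic d. \<beta> a ^ (?q ^ i) / \<beta> a) = 0" if "i < d"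
    using 1[OF lin] *(3)[OF that] by simp
qed

section \<open>Evaluation of the power sums\<close>

text \<open>Generalises \<open>of_A\<close> to an arbitrary point, because the q^i-th power of a(t)
  is the value of the same polynomial at t^(q^i), and because closed formulas come from letting the
  point vary.\<close>

definition eval_at :: "'a::field fls \<Rightarrow> 'a poly \<Rightarrow> 'a fls" where
  "eval_at T a = poly (map_poly fls_const a) T"

lemma of_A_conv_eval_at: "of_A = eval_at tt"
  by (simp add: fun_eq_iff of_A_def eval_at_def)

lemma eval_at_0 [simp]: "eval_at T 0 = 0"
  by (simp add: eval_at_def)

lemma eval_at_pCons [simp]: "eval_at T (pCons c a) = fls_const c + T * eval_at T a"
  by (simp add: eval_at_def map_poly_pCons)

lemma eval_at_add: "eval_at T (a + b) = eval_at T a + eval_at T b"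
  by (induction a b rule: poly_induct2) (simp_all add: algebra_simps flip: fls_plus_const)

lemma eval_at_smult: "eval_at T (smult c a) = fls_const c * eval_at T a"
  by (induction a) (simp_all add: algebra_simps flip: fls_const_mult_const)

lemma Fq_linear_eval_at: "Fq_linear (eval_at T)"
  by (simp add: Fq_linear_def eval_at_add eval_at_smult)

lemma eval_at_frobenius:
  fixes a :: "'a::{field,finite} poly"
  shows "eval_at T a ^ (CARD('a) ^ k) = eval_at (T ^ (CARD('a) ^ k)) a"
proof (induction a)
  case 0
  thus ?case using card_gt_0[where ?'a = 'a] by (simp add: power_0_left)
qed (simp add: frobenius_pow_add power_mult_distrib fls_const_frobenius)

lemma of_A_nth: "fls_nth (of_A a) n = (if n \<le> 0 then coeff a (nat (- n)) else 0)"
proof (induction a arbitrary: n)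
  case (pCons c a)
  have "fls_nth (of_A (pCons c a)) n = (if n = 0 then c else 0) + fls_nth (of_A a) (n + 1)"
    by (simp add: of_A_conv_eval_at tt_def fls_X_inv_times_conv_shift fls_const_nth)
  thus ?case
    by (auto simp: pCons coeff_pCons nat_diff_distrib split: nat.splits)
qed (simp add: of_A_def)

lemma inj_of_A: "inj of_A"
proof (rule injI)
  fix a b :: "'a poly" assume "of_A a = of_A b"
  hence "fls_nth (of_A a) (- int i) = fls_nth (of_A b) (- int i)" for i by simp
  thus "a = b" by (simp add: of_A_nth poly_eq_iff)
qed

lemma of_A_eq_0_iff [simp]: "of_A a = 0 \<longleftrightarrow> a = 0"
  using inj_of_A[THEN injD, of a 0] by (auto simp: of_A_def)

lemma A_monic_nonzero: "a \<in> A_monic d \<Longrightarrow> a \<noteq> 0"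
  by (auto simp: A_monic_def)

lemma Fq_linear_of_A_pow: "Fq_linear (\<lambda>a::'a::{field,finite} poly. of_A a ^ (CARD('a) ^ k))"
  unfolding of_A_conv_eval_at eval_at_frobenius by (rule Fq_linear_eval_at)

lemma inj_of_A_pow: "inj (\<lambda>a::'a::{field,finite} poly. of_A a ^ (CARD('a) ^ k))"
proof (rule injI)
  fix a b :: "'a poly" assume "of_A a ^ (CARD('a) ^ k) = of_A b ^ (CARD('a) ^ k)"
  hence "(of_A a - of_A b) ^ (CARD('a) ^ k) = 0" by (simp add: frobenius_pow_diff)
  hence "of_A a = of_A b" by simp
  thus "a = b" by (rule injD[OF inj_of_A])
qed

lemma tt_pow_inj: "(tt :: 'a::field fls) ^ m = tt ^ n \<Longrightarrow> m = n"
  by (drule arg_cong[of _ _ fls_subdegree]) (simp add: tt_def fls_subdegree_pow)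

lemma tt_pow_card_inj: "(tt :: 'a::{field,finite} fls) ^ (CARD('a) ^ m) = tt ^ (CARD('a) ^ n) \<Longrightarrow> m = n"
  using tt_pow_inj card_ge_2[where ?'a = 'a] by (metis One_nat_def Suc_1 Suc_le_lessD power_inject_exp)

section \<open>Multiplicativity of the power sums\<close>

definition S_below :: "nat \<Rightarrow> nat \<Rightarrow> 'a::{field,finite} fls" where
  "S_below d s = (\<Sum>j<d. S_sum j s)"

lemma inverse_pow_eq_prod:
  assumes "(x :: 'k::field) \<noteq> 0" "m + sum_list (map e ks) = r * N"
  shows "inverse (x ^ m) = prod_list (map (\<lambda>k. x ^ e k) ks) / (x ^ N) ^ r"
proof -
  have "prod_list (map (\<lambda>k. x ^ e k) ks) = x ^ sum_list (map e ks)"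
    by (induction ks) (auto simp: power_add)
  moreover have "(x ^ N) ^ r = x ^ m * x ^ sum_list (map e ks)"
    by (metis assms(2) mult.commute power_add power_mult)
  ultimately show ?thesis using assms(1) by (simp add: field_simps)
qed

text \<open>Dictionary to the general formulas: the forms are the powers a^(q^k), and
  \<open>\<beta>\<close> is a^(q^n). The exponent is given by an equation in order to avoid
  truncated subtraction.\<close>

lemma S_sum_eq_prod:
  fixes ks :: "nat list"
  assumes "m + (\<Sum>k\<leftarrow>ks. CARD('a::{field,finite}) ^ k) = r * CARD('a) ^ n"
  shows "(S_sum d m :: 'a fls) =
    (\<Sum>a\<in>A_monic d. prod_list (map (\<lambda>l. l a) (map (\<lambda>k a. of_A a ^ (CARD('a) ^ k)) ks)) / (of_A a ^ (CARD('a) ^ n)) ^ r)"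
  unfolding S_sum_def map_map o_def
  by (intro sum.cong refl inverse_pow_eq_prod) (use assms A_monic_nonzero in auto)

lemma S_sum_quotient:
  assumes "k \<le> n"
  shows "(\<Sum>a\<in>A_monic d. of_A a ^ (CARD('a) ^ k) / of_A a ^ (CARD('a) ^ n)) =
     (S_sum d (CARD('a) ^ n - CARD('a) ^ k) :: 'a::{field,finite} fls)"
  using S_sum_eq_prod[of "CARD('a) ^ n - CARD('a) ^ k" "[k]" 1 n d, where ?'a = 'a] assms card_gt_0[where ?'a = 'a]
  by (simp add: power_increasing)

lemma S_sum_card_pow: "(\<Sum>a\<in>A_monic d. 1 / of_A a ^ (CARD('a) ^ n)) = (S_sum d (CARD('a) ^ n) :: 'a::{field,finite} fls)"
  by (simp add: S_sum_def divide_inverse)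

lemma S_below_quotient:
  assumes "k \<le> n"
  shows "(\<Sum>j<d. \<Sum>a\<in>A_monic j. of_A a ^ (CARD('a) ^ k) / of_A a ^ (CARD('a) ^ n)) =
     (S_below d (CARD('a) ^ n - CARD('a) ^ k) :: 'a::{field,finite} fls)"
  using assms by (simp add: S_sum_quotient S_below_def)

text \<open>All degrees at once, with as many q^k subtracted as there are copies of q^n.\<close>

theorem S_below_prod:
  assumes "m + (\<Sum>k\<leftarrow>ks. CARD('a::{field,finite}) ^ k) = length ks * CARD('a) ^ n"
    and "length ks \<le> CARD('a)" and k: "\<And>k. k \<in> set ks \<Longrightarrow> k \<le> n"
  shows "(S_below (Suc d) m :: 'a fls) = (\<Prod>k\<leftarrow>ks. S_below (Suc d) (CARD('a) ^ n - CARD('a) ^ k))"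
proof -
  let ?ls = "map (\<lambda>k (a::'a poly). of_A a ^ (CARD('a) ^ k)) ks"
  have "S_below (Suc d) m = (\<Sum>j<Suc d. \<Sum>a\<in>A_monic j. prod_list (map (\<lambda>l. l a) ?ls) / (of_A a ^ (CARD('a) ^ n)) ^ length ?ls)"
    unfolding S_below_def by (intro sum.cong refl) (use S_sum_eq_prod[OF assms(1)] in simp)
  also have "\<dots> = prod_list (map (\<lambda>l. \<Sum>j<Suc d. \<Sum>a\<in>A_monic j. l a / of_A a ^ (CARD('a) ^ n)) ?ls)"
    by (intro sum_monic_below_prod Fq_linear_of_A_pow inj_of_A_pow)
       (use assms Fq_linear_of_A_pow in auto)
  also have "\<dots> = (\<Prod>k\<leftarrow>ks. S_below (Suc d) (CARD('a) ^ n - CARD('a) ^ k))"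
    unfolding map_map o_def
    by (intro arg_cong[of _ _ prod_list] map_cong refl S_below_quotient k)
  finally show ?thesis .
qed

text \<open>One degree, with fewer q^k than copies of q^n: each surplus copy contributes
  \<open>S_sum\<close>, while every q^k still contributes the sum over all degrees up to
  \<open>d\<close>.\<close>

theorem S_sum_prod_power:
  assumes "m + (\<Sum>k\<leftarrow>ks. CARD('a::{field,finite}) ^ k) = r * CARD('a) ^ n"
    and "length ks < r" "r \<le> CARD('a)" and k: "\<And>k. k \<in> set ks \<Longrightarrow> k \<le> n"
  shows "(S_sum d m :: 'a fls) = S_sum d (CARD('a) ^ n) ^ (r - length ks) *
     (\<Prod>k\<leftarrow>ks. S_below (Suc d) (CARD('a) ^ n - CARD('a) ^ k))"
proof -
  let ?ls = "map (\<lambda>k (a::'a poly). of_A a ^ (CARD('a) ^ k)) ks"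
  have "S_sum d m = (\<Sum>a\<in>A_monic d. prod_list (map (\<lambda>l. l a) ?ls) / (of_A a ^ (CARD('a) ^ n)) ^ r)"
    by (rule S_sum_eq_prod[OF assms(1)])
  also have "\<dots> = (\<Sum>a\<in>A_monic d. 1 / of_A a ^ (CARD('a) ^ n)) ^ (r - length ?ls) *
      prod_list (map (\<lambda>l. \<Sum>j<Suc d. \<Sum>a\<in>A_monic j. l a / of_A a ^ (CARD('a) ^ n)) ?ls)"
    by (intro sum_monic_prod_power Fq_linear_of_A_pow inj_of_A_pow)
       (use assms Fq_linear_of_A_pow in auto)
  also have "map (\<lambda>l. \<Sum>j<Suc d. \<Sum>a\<in>A_monic j. l a / of_A a ^ (CARD('a) ^ n)) ?ls =
      map (\<lambda>k. S_below (Suc d) (CARD('a) ^ n - CARD('a) ^ k)) ks"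
    unfolding map_map o_def by (intro map_cong refl S_below_quotient k)
  finally show ?thesis by (simp add: S_sum_card_pow)
qed

text \<open>One degree and one copy of q^n, from which up to q - 1 powers are subtracted; here the
  normalised single-degree sums multiply.\<close>

theorem S_sum_prod:
  assumes "m + (\<Sum>k\<leftarrow>ks. CARD('a::{field,finite}) ^ k) = CARD('a) ^ n"
    and "length ks < CARD('a)" and k: "\<And>k. k \<in> set ks \<Longrightarrow> k \<le> n"
  shows "(S_sum d m :: 'a fls) = S_sum d (CARD('a) ^ n) *
     (\<Prod>k\<leftarrow>ks. S_sum d (CARD('a) ^ n - CARD('a) ^ k) / S_sum d (CARD('a) ^ n))"
proof -
  let ?ls = "map (\<lambda>k (a::'a poly). of_A a ^ (CARD('a) ^ k)) ks"
  have "S_sum d m = (\<Sum>a\<in>A_monic d. prod_list (map (\<lambda>l. l a) ?ls) / of_A a ^ (CARD('a) ^ n))"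
    using S_sum_eq_prod[of m ks 1 n d, where ?'a = 'a] assms(1) by simp
  also have "\<dots> = (\<Sum>a\<in>A_monic d. 1 / of_A a ^ (CARD('a) ^ n)) *
      prod_list (map (\<lambda>l. (\<Sum>a\<in>A_monic d. l a / of_A a ^ (CARD('a) ^ n)) / (\<Sum>a\<in>A_monic d. 1 / of_A a ^ (CARD('a) ^ n))) ?ls)"
    by (intro sum_monic_prod Fq_linear_of_A_pow inj_of_A_pow)
       (use assms Fq_linear_of_A_pow in auto)
  also have "map (\<lambda>l. (\<Sum>a\<in>A_monic d. l a / of_A a ^ (CARD('a) ^ n)) / (\<Sum>a\<in>A_monic d. 1 / of_A a ^ (CARD('a) ^ n))) ?ls =
      map (\<lambda>k. S_sum d (CARD('a) ^ n - CARD('a) ^ k) / S_sum d (CARD('a) ^ n)) ks"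
    unfolding map_map o_def S_sum_card_pow
    by (intro map_cong refl arg_cong2[of _ _ _ _ "(/)"] S_sum_quotient k)
  finally show ?thesis by (simp add: S_sum_card_pow)
qed

lemma S_sum_card_pow_nonzero: "S_sum d (CARD('a) ^ n) \<noteq> (0 :: 'a::{field,finite} fls)"
  unfolding S_sum_card_pow[symmetric]
  by (rule sum_monic_prod(2)[where ls = "[]", OF Fq_linear_of_A_pow inj_of_A_pow])
     (use card_gt_0[where ?'a = 'a] in auto)

text \<open>
  As a polynomial in \<open>T\<close> the left-hand side has degree \<open>d\<close> with leading coefficient \<open>S_sum d (q ^ n)\<close>,
  and it vanishes at the Frobenius twists of \<open>tt ^ (q ^ n)\<close> because power sums with small exponents vanish.
\<close>
lemma sum_eval_at_quotient:
  "(\<Sum>a\<in>A_monic d. eval_at T a / of_A a ^ (CARD('a) ^ n)) =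
   (S_sum d (CARD('a) ^ n) :: 'a::{field,finite} fls) * (\<Prod>i<d. T - tt ^ (CARD('a) ^ (n + i)))"
proof -
  let ?\<beta> = "\<lambda>a::'a poly. of_A a ^ (CARD('a) ^ n)"
  let ?\<theta> = "\<lambda>i. tt ^ (CARD('a) ^ (n + i)) :: 'a fls"
  define P where "P = (\<Sum>a\<in>A_monic d. smult (1 / ?\<beta> a) (map_poly fls_const a))"
  define R where "R = smult (S_sum d (CARD('a) ^ n)) (\<Prod>i<d. [:- ?\<theta> i, 1:])"
  have polyP: "poly P x = (\<Sum>a\<in>A_monic d. eval_at x a / ?\<beta> a)" for x
    by (simp add: P_def poly_sum eval_at_def)
  have polyR: "poly R x = S_sum d (CARD('a) ^ n) * (\<Prod>i<d. x - ?\<theta> i)" for x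
    by (simp add: R_def poly_prod)
  have degR: "degree (\<Prod>i<d. [:- ?\<theta> i, 1:]) = d" "lead_coeff (\<Prod>i<d. [:- ?\<theta> i, 1:]) = 1"
    by (subst degree_prod_eq_sum_degree, auto simp: lead_coeff_prod)
  have "P = R"
  proof (rule poly_eqI_degree_lead_coeff[of P d R "?\<theta> ` {..<d}"])
    have "coeff P d = (\<Sum>a\<in>A_monic d. 1 / ?\<beta> a)"
      unfolding P_def coeff_sum by (intro sum.cong) (auto simp: coeff_map_poly A_monic_def)
    moreover have "coeff R d = S_sum d (CARD('a) ^ n)" using degR by (simp add: R_def)
    ultimately show "coeff P d = coeff R d" by (simp add: S_sum_card_pow)
    have "inj_on ?\<theta> {..<d}" by (rule inj_onI) (auto dest: tt_pow_card_inj)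
    thus "d \<le> card (?\<theta> ` {..<d})" by (simp add: card_image)
    show "degree P \<le> d" unfolding P_def
      by (intro degree_sum_le finite_A_monic order_trans[OF degree_smult_le] degree_le)
         (auto simp: A_monic_def coeff_map_poly coeff_eq_0)
    show "degree R \<le> d" unfolding R_def by (rule order_trans[OF degree_smult_le]) (simp add: degR)
    fix z assume "z \<in> ?\<theta> ` {..<d}"
    then obtain i where i: "i < d" "z = ?\<theta> i" by auto
    have "eval_at z a = ?\<beta> a ^ (CARD('a) ^ i)" for a :: "'a poly"
    proof -
      have "?\<beta> a ^ (CARD('a) ^ i) = of_A a ^ (CARD('a) ^ (n + i))" by (simp add: power_add power_mult)
      thus ?thesis by (simp add: of_A_conv_eval_at eval_at_frobenius i)
    qed
    hence "poly P z = (\<Sum>a\<in>A_monic d. ?\<beta> a ^ (CARD('a) ^ i) / ?\<beta> a)" by (simp only: polyP)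
    also have "\<dots> = 0"
      by (rule sum_monic_prod(3)[where ls = "[]", OF Fq_linear_of_A_pow inj_of_A_pow])
         (use card_gt_0[where ?'a = 'a] i in auto)
    also have "\<dots> = poly R z" unfolding polyR using i by (auto intro!: prod_zero)
    finally show "poly P z = poly R z" .
  qed
  thus ?thesis by (metis polyP polyR)
qed

section \<open>Closed formulas in terms of \<open>ell\<close>\<close>

lemma ell_Suc: "ell (Suc n) = ell n * (tt - tt ^ (CARD('a) ^ Suc n) :: 'a::{field,finite} fls)"
  by (simp add: ell_def)

lemma ell_0 [simp]: "ell 0 = 1"
  by (simp add: ell_def)

lemma ell_Suc_bracket: "ell (Suc n) = - (ell n * bracket (Suc n) :: 'a::{field,finite} fls)"
  by (simp add: ell_Suc bracket_def algebra_simps)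

lemma ell_nonzero [simp]: "ell n \<noteq> (0 :: 'a::{field,finite} fls)"
proof
  assume "ell n = (0 :: 'a fls)"
  then obtain i where i: "i \<in> {1..n}" "tt ^ (CARD('a) ^ 0) = (tt :: 'a fls) ^ (CARD('a) ^ i)"
    by (auto simp: ell_def)
  thus False using tt_pow_card_inj[OF i(2)] by simp
qed

lemma prod_tt_shift:
  "ell j * (\<Prod>i<d. tt - tt ^ (CARD('a) ^ (Suc j + i))) = (ell (d + j) :: 'a::{field,finite} fls)"
  by (induction d) (simp_all add: ell_Suc add_ac mult.assoc)

text \<open>The power sum with exponent q - 1 is computed twice: as S_d(1)^(q-1) by
  multiplicativity, and as S_d(q) \<open>ell d\<close> = S_d(1)^q \<open>ell d\<close> by putting T
  = t in \<open>sum_eval_at_quotient\<close>. Cancelling, which uses S_d(1) nonzero, leaves S_d(1)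
  \<open>ell d\<close> = 1.\<close>

lemma S_sum_one: "(S_sum d 1 :: 'a::{field,finite} fls) = 1 / ell d"
proof -
  let ?q = "CARD('a)" and ?c = "S_sum d 1 :: 'a fls"
  note q2 = card_ge_2[where ?'a = 'a]
  have nz: "?c \<noteq> 0" using S_sum_card_pow_nonzero[of d 0, where ?'a = 'a] by simp
  have "S_sum d (?q ^ 1 - ?q ^ 0) = (\<Sum>a\<in>A_monic d. of_A a / of_A a ^ (?q ^ 1) :: 'a fls)"
    using S_sum_quotient[of 0 1 d, where ?'a = 'a] by simp
  also have "\<dots> = S_sum d (?q ^ 1) * (\<Prod>i<d. tt - tt ^ (?q ^ (1 + i)))"
    using sum_eval_at_quotient[where T = "tt :: 'a fls" and d = d and n = 1] by (simp add: of_A_conv_eval_at)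
  also have "(\<Prod>i<d. tt - tt ^ (?q ^ (1 + i))) = (ell d :: 'a fls)"
    using prod_tt_shift[of 0 d, where ?'a = 'a] by simp
  finally have 1: "S_sum d (?q - 1) = S_sum d ?q * (ell d :: 'a fls)" by simp
  have "S_sum d (?q - 1) = ?c ^ (?q - 1)"
    using S_sum_prod_power[of "?q - 1" "[]" "?q - 1" 0 d, where ?'a = 'a] q2 by simp
  moreover have "S_sum d ?q = ?c ^ ?q"
    using S_sum_prod_power[of ?q "[]" ?q 0 d, where ?'a = 'a] q2 by simp
  ultimately have "?c ^ (?q - 1) = ?c ^ (?q - 1) * ?c * ell d"
    using 1 power_minus_mult[OF card_gt_0[where ?'a = 'a], of ?c] by simp
  hence "?c * ell d = 1" using nz by (simp add: mult.assoc)
  thus ?thesis by (simp add: field_simps)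
qed

lemma S_sum_frobenius: "S_sum d (m * CARD('a) ^ k) = (S_sum d m :: 'a::{field,finite} fls) ^ (CARD('a) ^ k)"
  by (simp add: S_sum_def frobenius_pow_sum power_mult power_inverse)

lemma S_below_frobenius: "S_below d (m * CARD('a) ^ k) = (S_below d m :: 'a::{field,finite} fls) ^ (CARD('a) ^ k)"
  by (simp add: S_below_def frobenius_pow_sum S_sum_frobenius)

lemma S_sum_card_pow_eq: "S_sum d (CARD('a) ^ n) = (1 / ell d ^ (CARD('a) ^ n) :: 'a::{field,finite} fls)"
  using S_sum_frobenius[of d 1 n, where ?'a = 'a] by (simp add: S_sum_one power_divide del: One_nat_def)

lemma S_sum_card_pow_minus_one:
  "S_sum d (CARD('a) ^ Suc j - 1) = (ell (d + j) / (ell j * ell d ^ (CARD('a) ^ Suc j)) :: 'a::{field,finite} fls)"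
proof -
  have "S_sum d (CARD('a) ^ Suc j - CARD('a) ^ 0) = (\<Sum>a\<in>A_monic d. of_A a / of_A a ^ (CARD('a) ^ Suc j) :: 'a fls)"
    using S_sum_quotient[of 0 "Suc j" d, where ?'a = 'a] by simp
  also have "\<dots> = S_sum d (CARD('a) ^ Suc j) * (\<Prod>i<d. tt - tt ^ (CARD('a) ^ (Suc j + i)))"
    using sum_eval_at_quotient[where T = "tt :: 'a fls" and d = d and n = "Suc j"] by (simp add: of_A_conv_eval_at)
  finally show ?thesis
    unfolding prod_tt_shift[of j d, symmetric]
    using S_sum_card_pow_eq[of d "Suc j", where ?'a = 'a] by simp
qed

lemma A_monic_0: "A_monic 0 = {1 :: 'a::field poly}"
  by (auto simp: A_monic_def elim!: degree_eq_zeroE simp: one_pCons)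

lemma S_sum_0 [simp]: "S_sum 0 s = 1"
  by (simp add: S_sum_def A_monic_0 of_A_def)

lemma S_below_card_pow_minus_one:
  "S_below (Suc d) (CARD('a) ^ j - 1) = (ell (d + j) / (ell j * ell d ^ (CARD('a) ^ j)) :: 'a::{field,finite} fls)"
proof (cases j)
  \<comment> \<open>Exponent 0 counts monic polynomials, and q^i is 0 in the field unless i = 0.
    This case serves the factors with \<open>k = n\<close> in
    \<open>S_below_card_pow_diff\<close>.\<close>
  case 0
  have "card (A_monic i :: 'a poly set) = CARD('a) ^ i" for i
  proof -
    have "bij_betw (\<lambda>a. a + monom 1 i) (polys_below i) (A_monic i :: 'a poly set)"
      by (rule bij_betwI[where g = "\<lambda>a. a - monom 1 i"])
         (auto simp: A_monic_eq mem_polys_below_Suc_iff, auto simp: polys_below_def)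
    thus ?thesis using bij_betw_same_card card_polys_below by metis
  qed
  hence "S_sum i 0 = (if i = 0 then 1 else 0 :: 'a fls)" for i
    by (simp add: S_sum_def of_nat_card_fls)
  thus ?thesis using 0 by (simp add: S_below_def)
next
  case (Suc i)
  let ?q = "CARD('a)"
  show ?thesis
  proof (induction d)
    case 0
    show ?case by (simp add: S_below_def)
  next
    case (Suc d)
    define Q where "Q = ?q ^ j"
    define x where "x = (tt :: 'a fls) ^ (?q ^ (Suc (d + j)))"
    define y where "y = (tt :: 'a fls) ^ Q"
    have ed: "ell (Suc d) ^ Q = ell d ^ Q * (y - x)"
    proof -
      have "((tt :: 'a fls) ^ (?q ^ Suc d)) ^ Q = x"
        by (simp add: x_def Q_def power_add mult_ac flip: power_mult)
      thus ?thesis by (simp add: ell_Suc power_mult_distrib Q_def frobenius_pow_diff y_def)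
    qed
    have yx: "y - x \<noteq> 0" using ed by auto
    have ej: "ell j = ell i * (tt - y)" by (simp add: \<open>j = Suc i\<close> ell_Suc y_def Q_def)
    have ty: "tt - y \<noteq> 0" using ej by auto
    have edj: "ell (Suc d + j) = ell (d + j) * (tt - x)" by (simp add: ell_Suc x_def)
    have "S_below (Suc (Suc d)) (Q - 1) = S_below (Suc d) (Q - 1) + (S_sum (Suc d) (Q - 1) :: 'a fls)"
      by (simp add: S_below_def)
    also have "\<dots> = ell (d + j) / (ell j * ell d ^ Q) + ell (d + j) / (ell i * ell (Suc d) ^ Q)"
      using Suc S_sum_card_pow_minus_one[of "Suc d" i, where ?'a = 'a] \<open>j = Suc i\<close> by (simp add: Q_def)
    also have "\<dots> = ell (Suc d + j) / (ell j * ell (Suc d) ^ Q)"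
    proof -
      \<comment> \<open>Adding one more degree telescopes: with u = tt - y and v = y - x, the
        numerator u + v is tt - x, the new factor of \<open>ell (Suc d + j)\<close>.\<close>
      have "e / (A * u * B) + e / (A * (B * v)) = e * (u + v) / (A * u * (B * v))"
        if "A \<noteq> 0" "B \<noteq> 0" "u \<noteq> 0" "v \<noteq> 0" for e A B u v :: "'a fls"
        using that by (simp add: field_simps)
      from this[OF _ _ ty yx, of "ell i" "ell d ^ Q" "ell (d + j)"] show ?thesis
        unfolding ed edj ej by simp
    qed
    finally show ?case by (simp add: Q_def)
  qed
qed

text \<open>Since q^n - q^k = (q^(n-k) - 1) q^k, this is a Frobenius power of the case k =
  0.\<close>

lemma S_below_card_pow_diff:
  assumes "k \<le> n"
  shows "S_below (Suc d) (CARD('a) ^ n - CARD('a) ^ k) =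
    (ell (d + (n - k)) / ell (n - k) :: 'a::{field,finite} fls) ^ (CARD('a) ^ k) / ell d ^ (CARD('a) ^ n)"
proof -
  have n: "CARD('a) ^ n = CARD('a) ^ (n - k) * CARD('a) ^ k"
    using assms by (simp flip: power_add)
  have "S_below (Suc d) (CARD('a) ^ n - CARD('a) ^ k) = (S_below (Suc d) (CARD('a) ^ (n - k) - 1) :: 'a fls) ^ (CARD('a) ^ k)"
    unfolding n by (subst S_below_frobenius[symmetric]) (simp add: diff_mult_distrib)
  thus ?thesis unfolding S_below_card_pow_minus_one
    by (simp add: n power_divide power_mult_distrib power_mult)
qed

lemma S_sum_card_pow_diff:
  assumes "k < n"
  shows "S_sum d (CARD('a) ^ n - CARD('a) ^ k) =
    (ell (d + (n - k) - 1) / ell (n - k - 1) :: 'a::{field,finite} fls) ^ (CARD('a) ^ k) / ell d ^ (CARD('a) ^ n)"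
proof -
  obtain i where i: "n = Suc (k + i)" using assms less_iff_Suc_add by blast
  have n: "CARD('a) ^ n = CARD('a) ^ Suc i * CARD('a) ^ k"
    by (simp add: i power_add)
  have "S_sum d (CARD('a) ^ n - CARD('a) ^ k) = (S_sum d (CARD('a) ^ Suc i - 1) :: 'a fls) ^ (CARD('a) ^ k)"
    unfolding n by (subst S_sum_frobenius[symmetric]) (simp add: diff_mult_distrib)
  thus ?thesis unfolding S_sum_card_pow_minus_one n
    by (simp add: i power_divide power_mult_distrib power_mult)
qed

section \<open>Convergence of multizeta values\<close>

text \<open>Valuation at least \<open>N\<close>, with 0 included; \<open>fls_subdegree\<close>
  cannot express this since it assigns 0 to the zero series.\<close>

definition val_ge :: "int \<Rightarrow> 'a::zero fls \<Rightarrow> bool" where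
  "val_ge N x \<longleftrightarrow> (\<forall>i<N. fls_nth x i = 0)"

lemma val_ge_0 [simp]: "val_ge N 0"
  by (simp add: val_ge_def)

lemma val_ge_mono: "val_ge N x \<Longrightarrow> M \<le> N \<Longrightarrow> val_ge M x"
  by (simp add: val_ge_def)

lemma val_ge_add: "val_ge N x \<Longrightarrow> val_ge N y \<Longrightarrow> val_ge N (x + y :: 'a::group_add fls)"
  by (simp add: val_ge_def)

lemma val_ge_diff: "val_ge N x \<Longrightarrow> val_ge N y \<Longrightarrow> val_ge N (x - y :: 'a::group_add fls)"
  by (simp add: val_ge_def)

lemma val_ge_sum: "(\<And>i. i \<in> A \<Longrightarrow> val_ge N (f i)) \<Longrightarrow> val_ge N (\<Sum>i\<in>A. f i :: 'a::ab_group_add fls)"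
  by (induction A rule: infinite_finite_induct) (auto intro: val_ge_add)

lemma val_ge_iff: "x \<noteq> 0 \<Longrightarrow> val_ge N x \<longleftrightarrow> N \<le> fls_subdegree x"
  unfolding val_ge_def
  by (metis fls_eq0_below_subdegree fls_subdegree_geI less_le_trans)

lemma val_ge_mult:
  fixes x y :: "'a::field fls"
  assumes "val_ge N x" "val_ge M y"
  shows "val_ge (N + M) (x * y)"
proof (cases "x = 0 \<or> y = 0")
  case False
  thus ?thesis using assms by (simp add: val_ge_iff)
qed auto

lemma dist_le_if_val_ge:
  fixes x y :: "'a::group_add fls"
  assumes "val_ge (int N) (x - y)"
  shows "dist x y \<le> (1 / 2) ^ N"
proof (cases "x = y")
  case False
  hence N: "int N \<le> fls_subdegree (x - y)" using assms by (simp add: val_ge_iff)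
  hence "dist x y = inverse (2 ^ nat (fls_subdegree (x - y)))"
    using False by (simp add: dist_fls_def)
  also have "\<dots> = (1 / 2) ^ nat (fls_subdegree (x - y))"
    by (simp add: power_one_over inverse_eq_divide)
  also have "\<dots> \<le> (1 / 2) ^ N" using N by (intro power_decreasing) auto
  finally show ?thesis .
qed simp

lemma has_sum_flsI:
  fixes f :: "'i \<Rightarrow> 'a::ab_group_add fls"
  assumes "\<And>N. \<exists>F0. finite F0 \<and> F0 \<subseteq> A \<and>
    (\<forall>F. finite F \<and> F0 \<subseteq> F \<and> F \<subseteq> A \<longrightarrow> val_ge (int N) (x - sum f F))"
  shows "(f has_sum x) A"
  unfolding has_sum_def
proof (rule tendstoI)
  fix e :: real assume "e > 0"
  then obtain N where N: "(1 / 2) ^ N < e" using real_arch_pow_inv[of e "1/2"] by auto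
  obtain F0 where F0: "finite F0 \<and> F0 \<subseteq> A \<and>
      (\<forall>F. finite F \<and> F0 \<subseteq> F \<and> F \<subseteq> A \<longrightarrow> val_ge (int N) (x - sum f F))"
    using assms[of N] by (elim exE) (rule that)
  show "\<forall>\<^sub>F F in finite_subsets_at_top A. dist (sum f F) x < e"
    unfolding eventually_finite_subsets_at_top
  proof (intro exI[of _ F0] conjI allI impI)
    show "finite F0" "F0 \<subseteq> A" using F0 by simp_all
    fix F assume "finite F \<and> F0 \<subseteq> F \<and> F \<subseteq> A"
    hence "val_ge (int N) (x - sum f F)" using F0 by simp
    from dist_le_if_val_ge[OF this] show "dist (sum f F) x < e"
      using N by (simp add: dist_commute)
  qed
qed

text \<open>Ordered 1/t-adic convergence. In this form series can be compared through partial sums,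
  also after an index shift.\<close>

definition fls_sums :: "(nat \<Rightarrow> 'a::ab_group_add fls) \<Rightarrow> 'a fls \<Rightarrow> bool" where
  "fls_sums h x \<longleftrightarrow> (\<forall>N. \<exists>n0. \<forall>n\<ge>n0. val_ge N (x - (\<Sum>d<n. h d)))"

lemma fls_sums_unique:
  assumes "fls_sums h x" "fls_sums h y"
  shows "x = y"
proof (rule ccontr)
  assume "x \<noteq> y"
  define N where "N = fls_subdegree (x - y) + 1"
  from assms obtain n0 n1 where "\<And>n. n \<ge> n0 \<Longrightarrow> val_ge N (x - (\<Sum>d<n. h d))"
     "\<And>n. n \<ge> n1 \<Longrightarrow> val_ge N (y - (\<Sum>d<n. h d))" unfolding fls_sums_def by meson
  from val_ge_diff[OF this(1)[of "max n0 n1"] this(2)[of "max n0 n1"]]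
  have "val_ge N (x - y)" by simp
  thus False using \<open>x \<noteq> y\<close> by (simp add: val_ge_iff N_def)
qed

text \<open>Completeness: the coefficient of the limit at \<open>n\<close> is a finite sum, because
  terms with index above \<open>n\<close> do not reach it.\<close>

lemma ex_fls_partial_sums:
  fixes h :: "nat \<Rightarrow> 'a::ab_group_add fls"
  assumes h: "\<And>d. val_ge (int d) (h d)"
  shows "\<exists>x. \<forall>N. val_ge (int N) (x - (\<Sum>d<N. h d))"
proof -
  define x where "x = fps_to_fls (Abs_fps (\<lambda>n. \<Sum>d\<le>n. fls_nth (h d) (int n)))"
  have "fls_nth (x - (\<Sum>d<N. h d)) i = 0" if i: "i < int N" for N i
  proof (cases "i < 0")
    case True
    hence "fls_nth (h d) i = 0" for d using h[of d] by (simp add: val_ge_def)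
    thus ?thesis using True by (simp add: x_def fls_nth_sum)
  next
    case False
    then obtain n where n: "i = int n" by (metis int_nat_eq not_less)
    have "(\<Sum>d<N. fls_nth (h d) i) = (\<Sum>d\<le>n. fls_nth (h d) i)"
      using h n i by (intro sum.mono_neutral_right) (auto simp: val_ge_def)
    thus ?thesis using n by (simp add: x_def fls_nth_sum)
  qed
  thus ?thesis by (auto simp: val_ge_def)
qed

text \<open>If the terms of grade \<open>d\<close> are finitely many and have valuation at least
  \<open>d\<close>, the family is genuinely summable, so \<open>infsum\<close> is not its default
  value, and grouping by grade gives an ordinary series.\<close>

lemma fls_sums_infsum_graded:
  fixes f :: "'i \<Rightarrow> 'a::ab_group_add fls"
  assumes fin: "\<And>d. finite {i \<in> A. \<rho> i = d}" and f: "\<And>i. i \<in> A \<Longrightarrow> val_ge (int (\<rho> i)) (f i)"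
  shows "fls_sums (\<lambda>d. \<Sum>i | i \<in> A \<and> \<rho> i = d. f i) (infsum f A)"
proof -
  define h where "h = (\<lambda>d. \<Sum>i | i \<in> A \<and> \<rho> i = d. f i)"
  have "val_ge (int d) (h d)" for d
    unfolding h_def by (intro val_ge_sum) (use f in auto)
  then obtain x where x: "\<And>N. val_ge (int N) (x - (\<Sum>d<N. h d))"
    using ex_fls_partial_sums by blast
  have "(f has_sum x) A"
  proof (rule has_sum_flsI)
    fix N
    define F0 where "F0 = {i \<in> A. \<rho> i < N}"
    have un: "F0 = (\<Union>d<N. {i \<in> A. \<rho> i = d})" by (auto simp: F0_def)
    have F0: "finite F0" "F0 \<subseteq> A" using fin by (auto simp: un)
    have sumF0: "sum f F0 = (\<Sum>d<N. h d)"
      unfolding un h_def by (subst sum.UNION_disjoint) (use fin in auto)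
    have "val_ge (int N) (x - sum f F)" if F: "finite F" "F0 \<subseteq> F" "F \<subseteq> A" for F
    proof -
      have "val_ge (int N) (f i)" if "i \<in> F - F0" for i
      proof (rule val_ge_mono[OF f])
        show "i \<in> A" using that F(3) by blast
        thus "int N \<le> int (\<rho> i)" using that by (simp add: F0_def)
      qed
      hence "val_ge (int N) (sum f (F - F0))" by (rule val_ge_sum)
      from val_ge_diff[OF x this] show ?thesis
        using F sum.subset_diff[of F0 F f] by (simp add: sumF0 algebra_simps)
    qed
    thus "\<exists>F0. finite F0 \<and> F0 \<subseteq> A \<and>
      (\<forall>F. finite F \<and> F0 \<subseteq> F \<and> F \<subseteq> A \<longrightarrow> val_ge (int N) (x - sum f F))"
      using F0 by blast
  qed
  hence "infsum f A = x" by (rule infsumI)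
  moreover have "fls_sums h x" unfolding fls_sums_def
  proof
    fix N :: int
    show "\<exists>n0. \<forall>n\<ge>n0. val_ge N (x - (\<Sum>d<n. h d))"
    proof (intro exI[of _ "nat N"] allI impI)
      fix n assume "nat N \<le> n"
      thus "val_ge N (x - (\<Sum>d<n. h d))" by (intro val_ge_mono[OF x]) simp
    qed
  qed
  ultimately show ?thesis by (simp add: h_def)
qed

lemma val_ge_S_sum: "val_ge (int (d * s)) (S_sum d s :: 'a::{field,finite} fls)"
  unfolding S_sum_def
proof (rule val_ge_sum)
  fix a :: "'a poly" assume a: "a \<in> A_monic d"
  have "fls_subdegree (of_A a) = - int d"
    by (rule fls_subdegree_eqI) (use a in \<open>auto simp: of_A_nth A_monic_def coeff_eq_0\<close>)
  thus "val_ge (int (d * s)) (inverse (of_A a ^ s))"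
    using A_monic_nonzero[OF a] by (subst val_ge_iff) (auto simp: fls_subdegree_pow)
qed

section \<open>Multizeta values of depth one and two as series\<close>

lemma zeta_1_sums:
  assumes "s > 0"
  shows "fls_sums (\<lambda>d. S_sum d s) (zeta [s] :: 'a::{field,finite} fls)"
proof -
  let ?A = "{ds :: nat list. length ds = length [s] \<and> sorted_wrt (>) ds}"
  let ?f = "\<lambda>ds. \<Prod>i<length [s]. S_sum (ds ! i) ([s] ! i) :: 'a fls"
  have fib: "{ds. ds \<in> ?A \<and> ds ! 0 = d} = {[d]}" for d
    by (auto simp: length_Suc_conv)
  have "fls_sums (\<lambda>d. \<Sum>ds | ds \<in> ?A \<and> ds ! 0 = d. ?f ds) (infsum ?f ?A)"
  proof (rule fls_sums_infsum_graded)
    show "finite {ds \<in> ?A. ds ! 0 = d}" for d unfolding fib by simp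
    show "val_ge (int (ds ! 0)) (?f ds)" for ds
    proof -
      have "ds ! 0 \<le> ds ! 0 * s" using assms by simp
      hence "int (ds ! 0) \<le> int (ds ! 0 * s)" by (simp only: of_nat_le_iff)
      from val_ge_mono[OF val_ge_S_sum this] show ?thesis by simp
    qed
  qed
  thus ?thesis unfolding fib zeta_def by simp
qed

text \<open>Grouping is by the larger degree d; the smaller one then runs over all values below d,
  which produces \<open>S_below d b\<close>.\<close>

lemma zeta_2_sums:
  assumes "a > 0" "b > 0"
  shows "fls_sums (\<lambda>d. S_sum d a * S_below d b) (zeta [a, b] :: 'a::{field,finite} fls)"
proof -
  let ?A = "{ds :: nat list. length ds = length [a, b] \<and> sorted_wrt (>) ds}"
  let ?f = "\<lambda>ds. \<Prod>i<length [a, b]. S_sum (ds ! i) ([a, b] ! i) :: 'a fls"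
  have fib: "{ds. ds \<in> ?A \<and> ds ! 0 = d} = (\<lambda>e. [d, e]) ` {..<d}" for d
    by (auto simp: length_Suc_conv numeral_2_eq_2)
  have f: "?f ds = S_sum (ds ! 0) a * S_sum (ds ! 1) b" for ds
    by (simp add: numeral_2_eq_2)
  have "fls_sums (\<lambda>d. \<Sum>ds | ds \<in> ?A \<and> ds ! 0 = d. ?f ds) (infsum ?f ?A)"
  proof (rule fls_sums_infsum_graded)
    show "finite {ds \<in> ?A. ds ! 0 = d}" for d unfolding fib by simp
    fix ds :: "nat list"
    have "val_ge (int (ds ! 0 * a) + int (ds ! 1 * b)) (?f ds)"
      unfolding f by (intro val_ge_mult val_ge_S_sum)
    moreover have "ds ! 0 \<le> ds ! 0 * a" using assms by simp
    hence "int (ds ! 0) \<le> int (ds ! 0 * a) + int (ds ! 1 * b)"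
      unfolding of_nat_add[symmetric] of_nat_le_iff by (rule trans_le_add1)
    ultimately show "val_ge (int (ds ! 0)) (?f ds)" by (rule val_ge_mono)
  qed
  moreover have "(\<Sum>ds | ds \<in> ?A \<and> ds ! 0 = d. ?f ds) = S_sum d a * S_below d b" for d
    unfolding fib f by (subst sum.reindex) (auto simp: inj_on_def S_below_def sum_distrib_left)
  ultimately show ?thesis unfolding zeta_def by simp
qed

text \<open>Summing the termwise relation gives a multiple of the series of \<open>zeta [m]\<close>
  plus a multiple of the same series delayed by one step; both have the same limit, hence the
  constant \<open>C + C'\<close>.\<close>

lemma zeta_2_eqI:
  fixes C C' :: "'a::{field,finite} fls"
  assumes pos: "a > 0" "b > 0" "m > 0"
  assumes eq: "\<And>d. S_sum (Suc d) a * S_below (Suc d) b =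
     C * S_sum d m + C' * (case d of 0 \<Rightarrow> 0 | Suc e \<Rightarrow> S_sum e m)"
  shows "zeta [a, b] = (C + C') * zeta [m]"
proof -
  let ?h = "\<lambda>d. S_sum d m :: 'a fls" and ?g = "\<lambda>d. S_sum d a * S_below d b :: 'a fls"
  let ?z = "zeta [m] :: 'a fls"
  \<comment> \<open>The term with d = 0 on the left vanishes because \<open>S_below 0 b\<close> is
    an empty sum; this accounts for the shift by one against the first series and by two against the
    second.\<close>
  have part: "(\<Sum>d<Suc (Suc n). ?g d) = C * (\<Sum>d<Suc n. ?h d) + C' * (\<Sum>d<n. ?h d)" for n
  proof (induction n)
    case 0
    show ?case using eq[of 0] by (simp add: S_below_def)
  next
    case (Suc n)
    show ?case unfolding sum.lessThan_Suc[of ?g "Suc (Suc n)"] Suc eq[of "Suc n"]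
      by (simp add: algebra_simps)
  qed
  have "fls_sums ?g ((C + C') * ?z)"
    unfolding fls_sums_def
  proof
    fix N :: int
    \<comment> \<open>Multiplication by a constant shifts the required precision by the valuation of
      that constant.\<close>
    have mult: "\<exists>M. \<forall>x. val_ge M x \<longrightarrow> val_ge N (c * x)" for c :: "'a fls"
    proof (cases "c = 0")
      case False
      have "val_ge (fls_subdegree c + (N - fls_subdegree c)) (c * x)" if "val_ge (N - fls_subdegree c) x" for x
        using False that by (intro val_ge_mult) (auto simp: val_ge_iff)
      thus ?thesis by auto
    qed simp
    obtain M M' where M: "\<And>x. val_ge M x \<Longrightarrow> val_ge N (C * x)" "\<And>x. val_ge M' x \<Longrightarrow> val_ge N (C' * x)"
      using mult[of C] mult[of C'] by blast
    obtain n0 n1 where n: "\<And>n. n \<ge> n0 \<Longrightarrow> val_ge M (?z - (\<Sum>d<n. ?h d))"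
       "\<And>n. n \<ge> n1 \<Longrightarrow> val_ge M' (?z - (\<Sum>d<n. ?h d))"
      using zeta_1_sums[OF pos(3), where ?'a = 'a] unfolding fls_sums_def by meson
    have "val_ge N ((C + C') * ?z - (\<Sum>d<n. ?g d))" if "n \<ge> Suc (Suc (max n0 n1))" for n
    proof -
      define k where "k = n - 2"
      have k: "n = Suc (Suc k)" "k \<ge> n0" "k \<ge> n1" using that by (auto simp: k_def)
      have "val_ge N (C * (?z - (\<Sum>d<Suc k. ?h d)) + C' * (?z - (\<Sum>d<k. ?h d)))"
        using k by (intro val_ge_add M n) auto
      thus ?thesis unfolding k(1) part by (simp add: algebra_simps)
    qed
    thus "\<exists>n0. \<forall>n\<ge>n0. val_ge N ((C + C') * ?z - (\<Sum>d<n. ?g d))" by blast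
  qed
  thus ?thesis using fls_sums_unique[OF zeta_2_sums[OF pos(1,2)]] by blast
qed

section \<open>The identities\<close>

text \<open>The preceding power sum in terms of \<open>ell d\<close>. For \<open>d = 0\<close> the
  factor tt - tt^(q^0) is 0, so one formula covers the missing term too.\<close>

lemma S_sum_pred_card_pow:
  "(case d of 0 \<Rightarrow> 0 | Suc e \<Rightarrow> S_sum e (CARD('a) ^ n)) =
   ((tt - tt ^ (CARD('a) ^ d)) ^ (CARD('a) ^ n) / ell d ^ (CARD('a) ^ n) :: 'a::{field,finite} fls)"
proof (cases d)
  case 0
  thus ?thesis using card_gt_0[where ?'a = 'a] by (simp add: power_0_left)
next
  case (Suc e)
  have "tt - tt ^ (CARD('a) ^ d) \<noteq> (0 :: 'a fls)"
    using ell_nonzero[of d, where ?'a = 'a] ell_Suc[of e, where ?'a = 'a] Suc by auto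
  thus ?thesis using Suc by (simp add: S_sum_card_pow_eq ell_Suc power_mult_distrib del: power_Suc)
qed

text \<open>Insert tt^(q^(k+n)) between the two powers. Only the second summand depends on
  \<open>d\<close>, and for q^(k+n) it is the numerator in
  \<open>S_sum_pred_card_pow\<close>.\<close>

lemma tt_frobenius_split:
  "(tt - tt ^ (CARD('a) ^ (d + k))) ^ (CARD('a) ^ n) =
   (tt - tt ^ (CARD('a) ^ k)) ^ (CARD('a) ^ n) + (tt - tt ^ (CARD('a) ^ d) :: 'a::{field,finite} fls) ^ (CARD('a) ^ (k + n))"
  unfolding frobenius_pow_diff by (simp add: algebra_simps flip: power_mult power_add)

lemma bracket_conv_tt: "tt - tt ^ (CARD('a) ^ n) = - (bracket n :: 'a::{field,finite} fls)"
  by (simp add: bracket_def)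

lemma minus_frobenius: "(- x) ^ (CARD('a) ^ n) = - (x ^ (CARD('a) ^ n) :: 'a::{field,finite} fls)"
  using frobenius_pow_diff[of 0 x n] card_gt_0[where ?'a = 'a] by (simp add: power_0_left)

text \<open>Derived from (-x)^q = -(x^q), which avoids distinguishing odd and even q.\<close>

lemma minus_power_card_minus_one: "(- x) ^ (CARD('a) - 1) = (x :: 'a::{field,finite} fls) ^ (CARD('a) - 1)"
proof (cases "x = 0")
  case False
  have "(- x) ^ (CARD('a) - 1) * - x = x ^ (CARD('a) - 1) * - x"
    using minus_frobenius[of x 1] power_minus_mult[OF card_gt_0[where ?'a = 'a], of x]
      power_minus_mult[OF card_gt_0[where ?'a = 'a], of "- x"] by simp
  thus ?thesis using False by simp
qed simp

lemma sum_list_upt_eq_sum: "sum_list (map f [1..<Suc s]) = (\<Sum>i=1..s. f i)"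
  by (induction s) (auto simp: add.commute)

lemma prod_list_upt_eq_prod: "prod_list (map f [1..<Suc s]) = (\<Prod>i=1..s. f i :: 'k::comm_monoid_mult)"
  by (induction s) (auto simp: mult.commute)

lemma zeta_identity_1:
  fixes k :: "nat \<Rightarrow> nat"
  defines "q \<equiv> CARD('a::{field,finite})"
  assumes n: "n > 0" and s: "1 \<le> s" "s < q" and k: "\<And>i. i \<in> {1..s} \<Longrightarrow> k i < n"
  shows "(zeta [q ^ n - (\<Sum>i=1..s. q ^ k i), (q - 1) * q ^ n] :: 'a fls) =
          (- 1) ^ s / ell 1 ^ (q ^ n) * (\<Prod>i=1..s. bracket (n - k i) ^ (q ^ k i)) *
          zeta [q ^ (n + 1) - (\<Sum>i=1..s. q ^ k i)]"
proof -
  let ?K = "\<Sum>i=1..s. q ^ k i" and ?ks = "map k [1..<Suc s]"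
  have q2: "q \<ge> 2" unfolding q_def by (rule card_ge_2)
  \<comment> \<open>At most q - 1 powers, each at most q^(n-1): the truncated subtractions below are
    true ones.\<close>
  have "?K \<le> (\<Sum>i=1..s. q ^ (n - 1))"
  proof (intro sum_mono power_increasing)
    show "k i \<le> n - 1" if "i \<in> {1..s}" for i using k[OF that] by simp
  qed (use q2 in auto)
  also have "\<dots> < q * q ^ (n - 1)" using s q2 by simp
  also have "\<dots> = q ^ n" using n by (simp flip: power_Suc)
  finally have K: "?K < q ^ n" .
  also have "q ^ n \<le> q ^ (n + 1)" using q2 by simp
  finally have K': "?K < q ^ (n + 1)" .
  have sumks: "(\<Sum>j\<leftarrow>?ks. q ^ j) = ?K"
    by (simp only: map_map o_def sum_list_upt_eq_sum)
  define C :: "'a fls" where "C = (- 1) ^ s / ell 1 ^ (q ^ n) * (\<Prod>i=1..s. bracket (n - k i) ^ (q ^ k i))"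
  have "zeta [q ^ n - ?K, (q - 1) * q ^ n] = (C + 0) * zeta [q ^ (n + 1) - ?K]"
  proof (rule zeta_2_eqI)
    show "q ^ n - ?K > 0" "(q - 1) * q ^ n > 0" "q ^ (n + 1) - ?K > 0" using K K' q2 by auto
    fix d
    have kn: "j < n" if "j \<in> set ?ks" for j using that k by auto
    have "S_sum (Suc d) (q ^ n - ?K) = S_sum (Suc d) (q ^ n) *
       (\<Prod>j\<leftarrow>?ks. S_sum (Suc d) (q ^ n - q ^ j) / (S_sum (Suc d) (q ^ n) :: 'a fls))"
      unfolding q_def
      by (rule S_sum_prod) (use sumks K s kn in \<open>auto simp: q_def less_imp_le simp del: upt_Suc\<close>)
    also have "(\<Prod>j\<leftarrow>?ks. S_sum (Suc d) (q ^ n - q ^ j) / (S_sum (Suc d) (q ^ n) :: 'a fls)) =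
        (\<Prod>i=1..s. S_sum (Suc d) (q ^ n - q ^ k i) / (S_sum (Suc d) (q ^ n)))"
      by (simp only: map_map o_def prod_list_upt_eq_prod)
    also have "\<dots> = (\<Prod>i=1..s. (ell (d + (n - k i)) / ell (n - k i - 1)) ^ (q ^ k i))"
      unfolding q_def using k by (intro prod.cong refl) (simp add: S_sum_card_pow_diff S_sum_card_pow_eq)
    finally have 1: "S_sum (Suc d) (q ^ n - ?K) = 1 / ell (Suc d) ^ (q ^ n) *
       (\<Prod>i=1..s. (ell (d + (n - k i)) / ell (n - k i - 1) :: 'a fls) ^ (q ^ k i))"
      by (simp add: q_def S_sum_card_pow_eq)
    have "(q - 1) * q ^ n = q ^ (n + 1) - q ^ n" by (simp add: diff_mult_distrib)
    hence 2: "S_below (Suc d) ((q - 1) * q ^ n) = (ell (d + 1) / ell 1 :: 'a fls) ^ (q ^ n) / ell d ^ (q ^ (n + 1))"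
      using S_below_card_pow_diff[of n "n + 1" d, where ?'a = 'a] by (simp add: q_def)
    have "S_sum d (q ^ (n + 1) - ?K) = S_sum d (q ^ (n + 1)) *
       (\<Prod>j\<leftarrow>?ks. S_sum d (q ^ (n + 1) - q ^ j) / (S_sum d (q ^ (n + 1)) :: 'a fls))"
      unfolding q_def
      by (rule S_sum_prod) (use sumks K' s kn in \<open>auto simp: q_def less_imp_le le_SucI simp del: upt_Suc\<close>)
    also have "(\<Prod>j\<leftarrow>?ks. S_sum d (q ^ (n + 1) - q ^ j) / (S_sum d (q ^ (n + 1)) :: 'a fls)) =
        (\<Prod>i=1..s. S_sum d (q ^ (n + 1) - q ^ k i) / (S_sum d (q ^ (n + 1))))"
      by (simp only: map_map o_def prod_list_upt_eq_prod)
    also have "\<dots> = (\<Prod>i=1..s. (ell (d + (n - k i)) / ell (n - k i)) ^ (q ^ k i))"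
    proof (intro prod.cong refl)
      fix i assume "i \<in> {1..s}"
      hence "k i < n" by (rule k)
      thus "S_sum d (q ^ (n + 1) - q ^ k i) / S_sum d (q ^ (n + 1)) = (ell (d + (n - k i)) / ell (n - k i) :: 'a fls) ^ (q ^ k i)"
        unfolding q_def by (subst S_sum_card_pow_diff, simp, subst S_sum_card_pow_eq, simp add: Suc_diff_le)
    qed
    finally have 3: "S_sum d (q ^ (n + 1) - ?K) = 1 / ell d ^ (q ^ (n + 1)) *
       (\<Prod>i=1..s. (ell (d + (n - k i)) / ell (n - k i) :: 'a fls) ^ (q ^ k i))"
      by (simp add: q_def S_sum_card_pow_eq del: power_Suc)
    \<comment> \<open>The two sides of the relation differ by \<open>ell (n - k i - 1)\<close>
      against \<open>ell (n - k i)\<close>; their ratio is minus a bracket, the source of the sign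
      (-1)^s and of the brackets in the identity.\<close>
    have "(\<Prod>i=1..s. (ell (d + (n - k i)) / ell (n - k i - 1) :: 'a fls) ^ (q ^ k i)) =
      (\<Prod>i=1..s. (- 1) * (bracket (n - k i) ^ (q ^ k i) * (ell (d + (n - k i)) / ell (n - k i)) ^ (q ^ k i)))"
    proof (intro prod.cong refl)
      fix i assume "i \<in> {1..s}"
      hence "k i < n" by (rule k)
      then obtain j where j: "n - k i = Suc j" by (metis Suc_diff_Suc)
      have "bracket (Suc j) \<noteq> (0 :: 'a fls)"
        using ell_Suc_bracket[of j, where ?'a = 'a] by auto
      hence *: "ell (d + Suc j) / ell j = - (bracket (Suc j) * (ell (d + Suc j) / ell (Suc j)) :: 'a fls)"
        unfolding ell_Suc_bracket[of j] by simp
      show "(ell (d + (n - k i)) / ell (n - k i - 1) :: 'a fls) ^ (q ^ k i) =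
         (- 1) * (bracket (n - k i) ^ (q ^ k i) * (ell (d + (n - k i)) / ell (n - k i)) ^ (q ^ k i))"
        unfolding j q_def by (simp only: * diff_Suc_1 minus_frobenius power_mult_distrib mult_minus_left mult_1_left)
    qed
    also have "\<dots> = (- 1) ^ s * (\<Prod>i=1..s. bracket (n - k i) ^ (q ^ k i)) *
      (\<Prod>i=1..s. (ell (d + (n - k i)) / ell (n - k i)) ^ (q ^ k i))"
      by (simp only: prod.distrib) simp
    finally show "S_sum (Suc d) (q ^ n - ?K) * S_below (Suc d) ((q - 1) * q ^ n) =
       C * S_sum d (q ^ (n + 1) - ?K) + 0 * (case d of 0 \<Rightarrow> 0 | Suc e \<Rightarrow> S_sum e (q ^ (n + 1) - ?K))"
      unfolding 1 2 3 C_def by (simp add: power_divide)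
  qed
  thus ?thesis by (simp add: C_def)
qed

text \<open>Both \<open>b\<close> and \<open>a + b\<close> are (s1 + s2) q^(n+1) minus a list of
  powers. The lists differ only by s1 copies of q^n, so the factors coming from the
  \<open>k i\<close> agree and need no evaluation.\<close>

lemma zeta_identity_2:
  fixes k :: "nat \<Rightarrow> nat"
  defines "q \<equiv> CARD('a::{field,finite})"
  assumes s: "1 \<le> s1" "s1 + s2 \<le> q" and k: "\<And>i. i \<in> {1..s2} \<Longrightarrow> k i \<le> n + 1"
    and a: "a = s1 * q ^ n"
    and b: "b = s1 * (q ^ (n + 1) - q ^ n) + (\<Sum>i=1..s2. q ^ (n + 1) - q ^ k i)"
  shows "(zeta [a, b] :: 'a fls) = 1 / ell 1 ^ (s1 * q ^ n) * zeta [a + b]"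
proof -
  let ?ks = "map k [1..<Suc s2]"
  have q2: "q \<ge> 2" unfolding q_def by (rule card_ge_2)
  have le: "q ^ n \<le> q ^ (n + 1)" using q2 by simp
  have lt: "q ^ n < q ^ (n + 1)" using q2 by simp
  have sumks: "(\<Sum>j\<leftarrow>?ks. q ^ j) = (\<Sum>i=1..s2. q ^ k i)"
    by (simp only: map_map o_def sum_list_upt_eq_sum)
  have "(\<Sum>i=1..s2. q ^ (n + 1) - q ^ k i) + (\<Sum>i=1..s2. q ^ k i) = (\<Sum>i=1..s2. q ^ (n + 1))"
    unfolding sum.distrib[symmetric]
    by (intro sum.cong refl le_add_diff_inverse2 power_increasing k) (use q2 in auto)
  hence S: "(\<Sum>i=1..s2. q ^ (n + 1) - q ^ k i) + (\<Sum>i=1..s2. q ^ k i) = s2 * q ^ (n + 1)" by simp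
  have s1: "s1 * (q ^ (n + 1) - q ^ n) + s1 * q ^ n = s1 * q ^ (n + 1)"
    using le by (simp flip: add_mult_distrib2)
  have "zeta [a, b] = (1 / ell 1 ^ (s1 * q ^ n) + 0) * (zeta [a + b] :: 'a fls)"
  proof (rule zeta_2_eqI)
    show "a > 0" "b > 0" "a + b > 0" using s q2 lt by (auto simp: a b)
    fix d
    let ?B = "\<lambda>j. S_below (Suc d) (q ^ (n + 1) - q ^ j) :: 'a fls"
    have 1: "S_sum (Suc d) a = (1 / ell (Suc d) ^ (q ^ n) :: 'a fls) ^ s1"
      using S_sum_prod_power[of a "[]" s1 n "Suc d", where ?'a = 'a] s a
      by (simp add: q_def S_sum_card_pow_eq)
    have "S_below (Suc d) b = (\<Prod>j\<leftarrow>replicate s1 n @ ?ks. ?B j)"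
      unfolding q_def
    proof (rule S_below_prod)
      have "b + (s1 * q ^ n + (\<Sum>i=1..s2. q ^ k i)) = (s1 + s2) * q ^ (n + 1)"
        using S s1 unfolding b by (simp add: add_mult_distrib)
      thus "b + (\<Sum>k\<leftarrow>replicate s1 n @ ?ks. CARD('a) ^ k) = length (replicate s1 n @ ?ks) * CARD('a) ^ (n + 1)"
        using sumks unfolding q_def by (simp add: sum_list_replicate map_replicate del: upt_Suc)
    qed (use s k in \<open>auto simp: q_def\<close>)
    hence 2: "S_below (Suc d) b = ?B n ^ s1 * (\<Prod>j\<leftarrow>?ks. ?B j)"
      by (simp add: prod_list_replicate map_replicate del: upt_Suc)
    have "S_sum d (a + b) = S_sum d (q ^ (n + 1)) ^ (s1 + s2 - length ?ks) * (\<Prod>j\<leftarrow>?ks. ?B j)"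
      unfolding q_def
    proof (rule S_sum_prod_power)
      have "a + b + (\<Sum>i=1..s2. q ^ k i) = (s1 + s2) * q ^ (n + 1)"
        using S s1 unfolding a b by (simp add: add_mult_distrib)
      thus "a + b + (\<Sum>k\<leftarrow>?ks. CARD('a) ^ k) = (s1 + s2) * CARD('a) ^ (n + 1)"
        using sumks unfolding q_def by simp
    qed (use s k in \<open>auto simp: q_def\<close>)
    hence 3: "S_sum d (a + b) = (1 / ell d ^ (q ^ (n + 1))) ^ s1 * (\<Prod>j\<leftarrow>?ks. ?B j)"
      by (simp add: q_def S_sum_card_pow_eq del: upt_Suc power_Suc)
    have 4: "?B n = (ell (Suc d) / ell 1 :: 'a fls) ^ (q ^ n) / ell d ^ (q ^ (n + 1))"
      using S_below_card_pow_diff[of n "n + 1" d, where ?'a = 'a] by (simp add: q_def)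
    show "S_sum (Suc d) a * S_below (Suc d) b = 1 / (ell 1 :: 'a fls) ^ (s1 * q ^ n) * S_sum d (a + b) +
       0 * (case d of 0 \<Rightarrow> 0 | Suc e \<Rightarrow> S_sum e (a + b))"
      unfolding 1 2 3 4 by (simp add: power_divide power_mult_distrib power_mult mult.commute[of s1] del: upt_Suc)
  qed
  thus ?thesis by simp
qed

text \<open>Identities (3) and (4) leave the same factor (tt - tt^(q^(d+2)))^q and differ only in
  \<open>D\<close>. It splits into -[2]^q, multiplying S_d(q^3), and a part that gives
  S_(d-1)(q^3).\<close>

lemma zeta_identity_3_4:
  fixes D :: "'a::{field,finite} fls"
  defines "q \<equiv> CARD('a)"
  assumes pos: "a > 0" "b > 0"
    and eq: "\<And>d. S_sum (Suc d) a * S_below (Suc d) b =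
        (tt - tt ^ (q ^ (d + 2))) ^ q / (D * ell d ^ (q ^ 3))"
  shows "zeta [a, b] = (1 - bracket 2 ^ q) / D * zeta [q ^ 3]"
proof -
  have "zeta [a, b] = (- (bracket 2 ^ q) / D + 1 / D) * zeta [q ^ 3]"
  proof (rule zeta_2_eqI[OF pos])
    show "q ^ 3 > 0" unfolding q_def using card_gt_0[where ?'a = 'a] by simp
    fix d
    have "(tt - tt ^ (q ^ (d + 2))) ^ q = (- bracket 2) ^ q + (tt - tt ^ (q ^ d) :: 'a fls) ^ (q ^ 3)"
      using tt_frobenius_split[of d 2 1, where ?'a = 'a] by (simp add: q_def bracket_conv_tt)
    also have "(- bracket 2) ^ q = - (bracket 2 ^ q :: 'a fls)"
      using minus_frobenius[of "bracket 2 :: 'a fls" 1] by (simp add: q_def)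
    finally show "S_sum (Suc d) a * S_below (Suc d) b = - (bracket 2 ^ q) / D * S_sum d (q ^ 3) +
        1 / D * (case d of 0 \<Rightarrow> 0 | Suc e \<Rightarrow> S_sum e (q ^ 3))"
      unfolding eq q_def S_sum_pred_card_pow
      by (simp add: S_sum_card_pow_eq add_divide_distrib diff_divide_distrib)
  qed
  thus ?thesis by (simp add: diff_divide_distrib)
qed

text \<open>The exponents decompose as q^2 minus q - 1 copies of 1, and as q times q^2 minus q - 1
  copies of q and one copy of 1.\<close>

lemma zeta_identity_3:
  defines "q \<equiv> CARD('a::{field,finite})"
  shows "(zeta [q ^ 2 - (q - 1), (q - 1) * (q ^ 2 + 1)] :: 'a fls) =
        (1 - bracket 2 ^ q) / (ell 1 ^ (q ^ 2 - 1) * ell 2) * zeta [q ^ 3]"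
  unfolding q_def
proof (rule zeta_identity_3_4, fold q_def)
  obtain p where p: "q = Suc p" "p > 0"
    using card_ge_2[where ?'a = 'a] unfolding q_def by (cases "CARD('a)") auto
  show "q ^ 2 - (q - 1) > 0" "(q - 1) * (q ^ 2 + 1) > 0"
    using p by (auto simp: power2_eq_square)
  fix d
  let ?e = "ell (d + 1) :: 'a fls" and ?f = "ell d :: 'a fls" and ?g = "ell (d + 2) :: 'a fls"
  have "S_sum (Suc d) (q ^ 2 - (q - 1)) = S_sum (Suc d) (q ^ 2) *
       (\<Prod>j\<leftarrow>replicate p 0. S_sum (Suc d) (q ^ 2 - q ^ j) / (S_sum (Suc d) (q ^ 2) :: 'a fls))"
    unfolding q_def
    by (rule S_sum_prod, fold q_def) (use p in \<open>auto simp: map_replicate sum_list_replicate power2_eq_square\<close>)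
  hence 1: "S_sum (Suc d) (q ^ 2 - (q - 1)) = 1 / ?e ^ (q ^ 2) * (?g / ell 1) ^ p"
    using S_sum_card_pow_diff[of 0 2 "Suc d", where ?'a = 'a]
    by (simp add: q_def map_replicate prod_list_replicate S_sum_card_pow_eq)
  have "S_below (Suc d) ((q - 1) * (q ^ 2 + 1)) = (\<Prod>j\<leftarrow>replicate p 1 @ [0]. S_below (Suc d) (q ^ 2 - q ^ j) :: 'a fls)"
    unfolding q_def
    by (rule S_below_prod, fold q_def)
       (use p in \<open>auto simp: map_replicate sum_list_replicate power2_eq_square algebra_simps\<close>)
  hence 2: "S_below (Suc d) ((q - 1) * (q ^ 2 + 1)) = ((?e / ell 1) ^ q / ?f ^ (q ^ 2)) ^ p * (?g / ell 2 / ?f ^ (q ^ 2))"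
    using S_below_card_pow_diff[of 0 2 d, where ?'a = 'a] S_below_card_pow_diff[of 1 2 d, where ?'a = 'a]
    by (simp add: q_def map_replicate prod_list_replicate)
  have g: "?g = ?e * (tt - tt ^ (q ^ (d + 2)))"
    using ell_Suc[of "d + 1", where ?'a = 'a] by (simp add: q_def)
  have pw: "?e ^ (q ^ 2) = (?e ^ q) ^ p * ?e ^ q" "?f ^ (q ^ 3) = (?f ^ (q ^ 2)) ^ p * ?f ^ (q ^ 2)"
     "x ^ q = x ^ p * x" "x ^ (q ^ 2 - 1) = x ^ p * (x ^ q) ^ p" for x :: "'a fls"
    unfolding p(1) by (simp_all add: power2_eq_square power3_eq_cube algebra_simps flip: power_mult power_add power_Suc)
  show "S_sum (Suc d) (q ^ 2 - (q - 1)) * S_below (Suc d) ((q - 1) * (q ^ 2 + 1)) =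
    (tt - tt ^ (q ^ (d + 2))) ^ q / (ell 1 ^ (q ^ 2 - 1) * ell 2 * ?f ^ (q ^ 3))"
  proof -
    \<comment> \<open>The field identity left once the powers of \<open>ell\<close> are variables:
      all but one factor E cancels, and g^q / E is the leftover Frobenius power.\<close>
    have eq: "1 / (E ^ p * E) * (g / l) ^ p * (((E / L) / Z) ^ p * (g / m / Z)) = (g ^ p * g / E) / (l ^ p * L ^ p * m * (Z ^ p * Z))"
      if "E \<noteq> 0" for E g l L m Z :: "'a fls"
      using that by (simp add: power_divide field_simps)
    have "(tt - tt ^ (q ^ (d + 2))) ^ q = ?g ^ q / ?e ^ q"
      unfolding g power_mult_distrib by simp
    hence "(tt - tt ^ (q ^ (d + 2))) ^ q = ?g ^ p * ?g / ?e ^ q"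
      unfolding pw(3)[of ?g] .
    thus ?thesis unfolding 1 2 pw(1,2,4) power_divide[of ?e "ell 1" q]
      using eq[where E = "?e ^ q" and g = ?g and l = "ell 1" and L = "ell 1 ^ q" and m = "ell 2" and Z = "?f ^ (q ^ 2)"] by simp
  qed
qed

text \<open>Here the exponents are two copies of q minus 1, and q times q^2 minus q - 1 copies of 1
  and one copy of q.\<close>

lemma zeta_identity_4:
  defines "q \<equiv> CARD('a::{field,finite})"
  shows "(zeta [2 * q - 1, (q - 1) * (q ^ 2 + q - 1)] :: 'a fls) =
        (1 - bracket 2 ^ q) / (ell 1 ^ (q + 1) * ell 2 ^ (q - 1)) * zeta [q ^ 3]"
  unfolding q_def
proof (rule zeta_identity_3_4, fold q_def)
  obtain p where p: "q = Suc p" "p > 0"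
    using card_ge_2[where ?'a = 'a] unfolding q_def by (cases "CARD('a)") auto
  show "2 * q - 1 > 0" "(q - 1) * (q ^ 2 + q - 1) > 0"
    using p by (auto simp: power2_eq_square)
  fix d
  let ?e = "ell (d + 1) :: 'a fls" and ?f = "ell d :: 'a fls" and ?g = "ell (d + 2) :: 'a fls"
  have "S_sum (Suc d) (2 * q - 1) = S_sum (Suc d) (q ^ 1) ^ (2 - length [0::nat]) *
       (\<Prod>j\<leftarrow>[0]. S_below (Suc (Suc d)) (q ^ 1 - q ^ j) :: 'a fls)"
    unfolding q_def
    by (rule S_sum_prod_power, fold q_def) (use p in \<open>auto\<close>)
  hence 1: "S_sum (Suc d) (2 * q - 1) = 1 / ?e ^ q * (?g / ell 1 / ?e ^ q)"
    using S_below_card_pow_diff[of 0 1 "Suc d", where ?'a = 'a] S_sum_card_pow_eq[of "Suc d" 1, where ?'a = 'a]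
    by (simp add: q_def)
  have "S_below (Suc d) ((q - 1) * (q ^ 2 + q - 1)) = (\<Prod>j\<leftarrow>replicate p 0 @ [1]. S_below (Suc d) (q ^ 2 - q ^ j) :: 'a fls)"
    unfolding q_def
    by (rule S_below_prod, fold q_def)
       (use p in \<open>auto simp: map_replicate sum_list_replicate power2_eq_square algebra_simps\<close>)
  hence 2: "S_below (Suc d) ((q - 1) * (q ^ 2 + q - 1)) = (?g / ell 2 / ?f ^ (q ^ 2)) ^ p * ((?e / ell 1) ^ q / ?f ^ (q ^ 2))"
    using S_below_card_pow_diff[of 0 2 d, where ?'a = 'a] S_below_card_pow_diff[of 1 2 d, where ?'a = 'a]
    by (simp add: q_def map_replicate prod_list_replicate)
  have g: "?g = ?e * (tt - tt ^ (q ^ (d + 2)))"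
    using ell_Suc[of "d + 1", where ?'a = 'a] by (simp add: q_def)
  have pw: "?f ^ (q ^ 3) = (?f ^ (q ^ 2)) ^ p * ?f ^ (q ^ 2)"
     "x ^ q = x ^ p * x" for x :: "'a fls"
    unfolding p(1) by (simp_all add: power2_eq_square power3_eq_cube algebra_simps flip: power_mult power_add power_Suc)
  show "S_sum (Suc d) (2 * q - 1) * S_below (Suc d) ((q - 1) * (q ^ 2 + q - 1)) =
    (tt - tt ^ (q ^ (d + 2))) ^ q / (ell 1 ^ (q + 1) * ell 2 ^ (q - 1) * ?f ^ (q ^ 3))"
  proof -
    have eq: "1 / E * (g / l / E) * ((g / m / Z) ^ p * (E / L / Z)) = (g ^ p * g / E) / (l * L * m ^ p * (Z ^ p * Z))"
      if "E \<noteq> 0" for E g l L m Z :: "'a fls"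
      using that by (simp add: power_divide field_simps)
    have "(tt - tt ^ (q ^ (d + 2))) ^ q = ?g ^ q / ?e ^ q"
      unfolding g power_mult_distrib by simp
    hence "(tt - tt ^ (q ^ (d + 2))) ^ q = ?g ^ p * ?g / ?e ^ q"
      unfolding pw(2)[of ?g] .
    moreover have "ell 1 ^ (q + 1) = ell 1 * (ell 1 :: 'a fls) ^ q" "q - 1 = p" using p by simp_all
    ultimately show ?thesis unfolding 1 2 pw(1) power_divide[of ?e "ell 1" q]
      using eq[where E = "?e ^ q" and g = ?g and l = "ell 1" and L = "ell 1 ^ q" and m = "ell 2" and Z = "?f ^ (q ^ 2)"] by simp
  qed
qed

text \<open>No product formula is needed: both exponents have closed forms, and the quotient of
  consecutive \<open>ell\<close> leaves tt - tt^(q^(d+2)), which splits into two terms.\<close>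

lemma zeta_identity_5:
  defines "q \<equiv> CARD('a::{field,finite})"
  shows "(zeta [1, q ^ 2 - 1] :: 'a fls) = zeta [q ^ 2] * (1 / ell 1 + 1 / ell 2)"
proof -
  have q2: "q \<ge> 2" unfolding q_def by (rule card_ge_2)
  have "zeta [1, q ^ 2 - 1] = (1 / ell 1 + 1 / ell 2) * (zeta [q ^ 2] :: 'a fls)"
  proof (rule zeta_2_eqI)
    have "1 < q ^ 2" using q2 by (intro one_less_power) auto
    thus "q ^ 2 - 1 > 0" "q ^ 2 > 0" using q2 by simp_all
    fix d
    have l2: "ell 2 = ell 1 * (tt - tt ^ (q ^ 2) :: 'a fls)"
      using ell_Suc[of 1, where ?'a = 'a] by (simp add: q_def numeral_2_eq_2)
    have nz: "tt - tt ^ (q ^ 2) \<noteq> (0 :: 'a fls)" using l2 by auto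
    have e2: "ell (d + 2) = ell (Suc d) * (tt - tt ^ (q ^ (d + 2)) :: 'a fls)"
      using ell_Suc[of "Suc d", where ?'a = 'a] by (simp add: q_def)
    have "S_sum (Suc d) 1 * S_below (Suc d) (q ^ 2 - 1) = 1 / ell (Suc d) * (ell (d + 2) / (ell 2 * ell d ^ (q ^ 2)) :: 'a fls)"
      by (simp only: q_def S_sum_one S_below_card_pow_minus_one)
    also have "\<dots> = (tt - tt ^ (q ^ (d + 2))) / (ell 2 * ell d ^ (q ^ 2))"
      unfolding e2 by simp
    also have "tt - tt ^ (q ^ (d + 2)) = (tt - tt ^ (q ^ 2)) + (tt - tt ^ (q ^ d) :: 'a fls) ^ (q ^ 2)"
      using tt_frobenius_split[of d 2 0, where ?'a = 'a] by (simp add: q_def)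
    also have "\<dots> / (ell 2 * ell d ^ (q ^ 2)) = 1 / ell 1 * (1 / ell d ^ (q ^ 2)) +
        1 / ell 2 * ((tt - tt ^ (q ^ d)) ^ (q ^ 2) / ell d ^ (q ^ 2))"
      using nz by (simp add: add_divide_distrib l2)
    finally show "S_sum (Suc d) 1 * S_below (Suc d) (q ^ 2 - 1) = 1 / (ell 1 :: 'a fls) * S_sum d (q ^ 2) +
        1 / ell 2 * (case d of 0 \<Rightarrow> 0 | Suc e \<Rightarrow> S_sum e (q ^ 2))"
      unfolding q_def S_sum_pred_card_pow unfolding S_sum_card_pow_eq .
  qed simp
  thus ?thesis by (simp add: mult.commute)
qed

text \<open>\<open>N\<close> stands for n - j. The exponents are q - 1 copies of q^n minus 1; q
  copies of q^(n+1) minus q - 1 copies of q^n and one q^N; and q^(n+2) minus q^N and 1. The first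
  and third decompositions fit the product formulas exactly when q > 2.\<close>

lemma zeta_identity_6:
  defines "q \<equiv> CARD('a::{field,finite})"
  assumes q: "q > 2" and N: "N \<le> n + 1"
  shows "(zeta [(q - 1) * q ^ n - 1, (q - 1) * q ^ (n + 1) + q ^ n - q ^ N] :: 'a fls) =
          - (bracket (n + 1) / bracket 1 ^ ((q - 1) * q ^ n)) * zeta [q ^ (n + 2) - q ^ N - 1]"
proof -
  obtain p where p: "q = Suc (Suc p)" "p > 0"
    using q by (metis Suc_lessE less_Suc_eq_0_disj not_less_eq numeral_2_eq_2)
  define X where "X = q ^ n"
  have X: "X \<ge> 1" "q ^ (n + 1) = q * X" "q ^ (n + 2) = q * (q * X)" using p by (auto simp: X_def)
  have NX: "q ^ N \<le> q * X" unfolding X(2)[symmetric] using N p by (intro power_increasing) auto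
  have a: "(q - 1) * q ^ n - 1 + 1 = (q - 1) * X" using X p by (simp add: X_def)
  have b: "(q - 1) * q ^ (n + 1) + q ^ n - q ^ N + ((q - 1) * X + q ^ N) = q * (q * X)"
  proof -
    have "q * X \<le> (q - 1) * (q * X)" using p by simp
    hence "q ^ N \<le> (q - 1) * (q * X) + X" using NX by linarith
    moreover have "(q - 1) * (q * X) + X + (q - 1) * X = q * (q * X)"
      unfolding p by (simp add: algebra_simps)
    ultimately show ?thesis unfolding X X_def[symmetric] by linarith
  qed
  have big: "q ^ N + 1 < q * (q * X)"
  proof -
    have "q * X + q * X \<le> q * (q * X)" using p by simp
    moreover have "q * X > 1" using X p by simp
    ultimately show ?thesis using NX by linarith
  qed
  define C :: "'a fls" where "C = - (bracket (n + 1) / bracket 1 ^ ((q - 1) * q ^ n))"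
  have "zeta [(q - 1) * q ^ n - 1, (q - 1) * q ^ (n + 1) + q ^ n - q ^ N] = (C + 0) * (zeta [q ^ (n + 2) - q ^ N - 1] :: 'a fls)"
  proof (rule zeta_2_eqI)
    \<comment> \<open>For n = 0 the first exponent is q - 2, so positivity needs q > 2.\<close>
    have "1 * 2 \<le> X * (q - 1)" using X p by (intro mult_le_mono) auto
    thus "(q - 1) * q ^ n - 1 > 0" by (simp add: X_def mult.commute)
    have "q * X \<le> (q - 1) * (q * X)" using p by simp
    thus "(q - 1) * q ^ (n + 1) + q ^ n - q ^ N > 0" using NX X unfolding X(2) X_def[symmetric] by linarith
    show "q ^ (n + 2) - q ^ N - 1 > 0" using big unfolding X by simp
    fix d
    let ?e = "ell (d + 1) :: 'a fls" and ?f = "ell d :: 'a fls" and ?g = "ell (d + (n + 1)) :: 'a fls"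
    let ?J = "(ell (d + (n + 1 - N)) / ell (n + 1 - N) :: 'a fls) ^ (q ^ N)"
    have "S_sum (Suc d) ((q - 1) * q ^ n - 1) = S_sum (Suc d) (q ^ n) ^ (q - 1 - length [0::nat]) *
       (\<Prod>j\<leftarrow>[0]. S_below (Suc (Suc d)) (q ^ n - q ^ j) :: 'a fls)"
      unfolding q_def
      by (rule S_sum_prod_power, fold q_def) (use p a in \<open>auto simp: X_def\<close>)
    moreover have "q - 1 - length [0::nat] = p" using p by simp
    moreover have "S_sum (Suc d) (q ^ n) = 1 / ?e ^ X" by (simp add: q_def X_def S_sum_card_pow_eq)
    moreover have "S_below (Suc (Suc d)) (q ^ n - q ^ 0) = ?g / ell n / ?e ^ X"
      using S_below_card_pow_diff[of 0 n "Suc d", where ?'a = 'a] by (simp add: q_def X_def)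
    ultimately have 1: "S_sum (Suc d) ((q - 1) * q ^ n - 1) = (1 / ?e ^ X) ^ p * (?g / ell n / ?e ^ X)"
      by (simp only: list.map prod_list.Cons prod_list.Nil mult_1_right)
    have "S_below (Suc d) ((q - 1) * q ^ (n + 1) + q ^ n - q ^ N) =
       (\<Prod>j\<leftarrow>replicate (Suc p) n @ [N]. S_below (Suc d) (q ^ (n + 1) - q ^ j) :: 'a fls)"
      unfolding q_def
    proof (rule S_below_prod, fold q_def)
      have "q - 1 = Suc p" using p by simp
      thus "(q - 1) * q ^ (n + 1) + q ^ n - q ^ N + (\<Sum>j\<leftarrow>replicate (Suc p) n @ [N]. q ^ j) =
         length (replicate (Suc p) n @ [N]) * q ^ (n + 1)"
        using b unfolding X(2) by (simp add: map_replicate sum_list_replicate X_def p del: replicate_Suc)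
    qed (use p N in auto)
    hence 2: "S_below (Suc d) ((q - 1) * q ^ (n + 1) + q ^ n - q ^ N) =
       ((?e / ell 1) ^ X / ?f ^ (q * X)) ^ Suc p * (?J / ?f ^ (q * X))"
      using S_below_card_pow_diff[of n "n + 1" d, where ?'a = 'a]
        S_below_card_pow_diff[OF N, of d, where ?'a = 'a]
      by (simp add: q_def[symmetric] X_def map_replicate prod_list_replicate del: replicate_Suc)
    have "S_sum d (q ^ (n + 2) - q ^ N - 1) = S_sum d (q ^ (n + 2)) *
       (\<Prod>j\<leftarrow>[N, 0]. S_sum d (q ^ (n + 2) - q ^ j) / (S_sum d (q ^ (n + 2)) :: 'a fls))"
      unfolding q_def
      by (rule S_sum_prod, fold q_def) (use p N big X in auto)
    hence 3: "S_sum d (q ^ (n + 2) - q ^ N - 1) = 1 / ?f ^ (q * (q * X)) * (?J * (?g / ell (n + 1)))"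
      using S_sum_card_pow_diff[of N "n + 2" d, where ?'a = 'a] S_sum_card_pow_diff[of 0 "n + 2" d, where ?'a = 'a] N
      by (simp add: q_def[symmetric] X_def Suc_diff_le S_sum_card_pow_eq[of d "n + 2", where ?'a = 'a, folded q_def, simplified])
    \<comment> \<open>The exponent is a multiple of q - 1 and absorbs the sign between
      \<open>bracket 1\<close> and \<open>ell 1\<close>; the minus sign of the identity comes from
      \<open>bracket (n + 1)\<close> alone.\<close>
    have l1: "bracket 1 ^ ((q - 1) * q ^ n) = ((ell 1 :: 'a fls) ^ X) ^ Suc p"
    proof -
      have "bracket 1 = - (ell 1 :: 'a fls)" using ell_Suc_bracket[of 0, where ?'a = 'a] by simp
      hence "bracket 1 ^ ((q - 1) * q ^ n) = ((ell 1 :: 'a fls) ^ (q - 1)) ^ X"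
        using minus_power_card_minus_one[of "ell 1 :: 'a fls"] by (simp add: power_mult q_def[symmetric] X_def)
      moreover have "q - 1 = Suc p" using p by simp
      moreover have "((ell 1 :: 'a fls) ^ Suc p) ^ X = (ell 1 ^ X) ^ Suc p"
        by (simp only: power_mult[symmetric] mult.commute)
      ultimately show ?thesis by metis
    qed
    have ln: "bracket (n + 1) = - (ell (n + 1) / ell n :: 'a fls)"
      using ell_Suc_bracket[of n, where ?'a = 'a] by simp
    have pw: "?f ^ (q * (q * X)) = (?f ^ (q * X)) ^ Suc p * ?f ^ (q * X)"
      unfolding p(1) by (simp add: algebra_simps flip: power_mult power_add power_Suc)
    have eq: "(1 / E) ^ p * (g / m / E) * ((E / L / Z) ^ Suc p * (J / Z)) =
      - (- (h / m) / L ^ Suc p) * (1 / (Z ^ Suc p * Z) * (J * (g / h)))"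
      if "E \<noteq> 0" "h \<noteq> 0" for E g m L Z J h :: "'a fls"
      using that by (simp add: power_divide field_simps)
    show "S_sum (Suc d) ((q - 1) * q ^ n - 1) * S_below (Suc d) ((q - 1) * q ^ (n + 1) + q ^ n - q ^ N) =
       C * S_sum d (q ^ (n + 2) - q ^ N - 1) + 0 * (case d of 0 \<Rightarrow> 0 | Suc e \<Rightarrow> S_sum e (q ^ (n + 2) - q ^ N - 1))"
      unfolding 1 2 3 C_def l1 ln pw power_divide[of ?e "ell 1" X] mult_zero_left add_0_right
      by (rule eq) simp_all
  qed
  thus ?thesis by (simp add: C_def)
qed

theorem theorem3p1:
  fixes q :: nat
  assumes q: "q = CARD('a::{field,finite})"
  shows
    "(\<forall>(n::nat) (s::nat) (k::nat \<Rightarrow> nat).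
        n > 0 \<and> 1 \<le> s \<and> s < q \<and> (\<forall>i\<in>{1..s}. k i < n) \<longrightarrow>
        (zeta [q ^ n - (\<Sum>i=1..s. q ^ k i), (q - 1) * q ^ n] :: 'a fls) =
          (- 1) ^ s / ell 1 ^ (q ^ n) * (\<Prod>i=1..s. bracket (n - k i) ^ (q ^ k i)) *
          zeta [q ^ (n + 1) - (\<Sum>i=1..s. q ^ k i)]) \<and>
     (\<forall>(n::nat) (s1::nat) (s2::nat) (k::nat \<Rightarrow> nat) (a::nat) (b::nat).
        1 \<le> s1 \<and> s1 \<le> q \<and> s2 \<le> q - s1 \<and> (\<forall>i\<in>{1..s2}. k i \<le> n + 1) \<and>
        a = s1 * q ^ n \<and>
        b = s1 * (q ^ (n + 1) - q ^ n) + (\<Sum>i=1..s2. q ^ (n + 1) - q ^ k i) \<longrightarrow>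
        (zeta [a, b] :: 'a fls) = 1 / ell 1 ^ (s1 * q ^ n) * zeta [a + b]) \<and>
     (zeta [q ^ 2 - (q - 1), (q - 1) * (q ^ 2 + 1)] :: 'a fls) =
        (1 - bracket 2 ^ q) / (ell 1 ^ (q ^ 2 - 1) * ell 2) * zeta [q ^ 3] \<and>
     (zeta [2 * q - 1, (q - 1) * (q ^ 2 + q - 1)] :: 'a fls) =
        (1 - bracket 2 ^ q) / (ell 1 ^ (q + 1) * ell 2 ^ (q - 1)) * zeta [q ^ 3] \<and>
     (zeta [1, q ^ 2 - 1] :: 'a fls) = zeta [q ^ 2] * (1 / ell 1 + 1 / ell 2) \<and>
     (q > 2 \<longrightarrow>
       (\<forall>(n::nat) (j::int). - 1 \<le> j \<and> j \<le> int n \<longrightarrow>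
        (zeta [(q - 1) * q ^ n - 1, (q - 1) * q ^ (n + 1) + q ^ n - q ^ nat (int n - j)] :: 'a fls) =
          - (bracket (n + 1) / bracket 1 ^ ((q - 1) * q ^ n)) *
          zeta [q ^ (n + 2) - q ^ nat (int n - j) - 1]))"
  unfolding q
proof (intro conjI allI impI)
  fix n s :: nat and k :: "nat \<Rightarrow> nat"
  assume "n > 0 \<and> 1 \<le> s \<and> s < CARD('a) \<and> (\<forall>i\<in>{1..s}. k i < n)"
  thus "(zeta [CARD('a) ^ n - (\<Sum>i=1..s. CARD('a) ^ k i), (CARD('a) - 1) * CARD('a) ^ n] :: 'a fls) =
          (- 1) ^ s / ell 1 ^ (CARD('a) ^ n) * (\<Prod>i=1..s. bracket (n - k i) ^ (CARD('a) ^ k i)) *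
          zeta [CARD('a) ^ (n + 1) - (\<Sum>i=1..s. CARD('a) ^ k i)]"
    by (intro zeta_identity_1) auto
next
  fix n s1 s2 :: nat and k :: "nat \<Rightarrow> nat" and a b :: nat
  assume "1 \<le> s1 \<and> s1 \<le> CARD('a) \<and> s2 \<le> CARD('a) - s1 \<and> (\<forall>i\<in>{1..s2}. k i \<le> n + 1) \<and>
        a = s1 * CARD('a) ^ n \<and>
        b = s1 * (CARD('a) ^ (n + 1) - CARD('a) ^ n) + (\<Sum>i=1..s2. CARD('a) ^ (n + 1) - CARD('a) ^ k i)"
  thus "(zeta [a, b] :: 'a fls) = 1 / ell 1 ^ (s1 * CARD('a) ^ n) * zeta [a + b]"
    by (intro zeta_identity_2[where k = k and ?s2.0 = s2]) auto
next
  fix n :: nat and j :: int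
  assume "CARD('a) > 2" and j: "- 1 \<le> j \<and> j \<le> int n"
  thus "(zeta [(CARD('a) - 1) * CARD('a) ^ n - 1,
            (CARD('a) - 1) * CARD('a) ^ (n + 1) + CARD('a) ^ n - CARD('a) ^ nat (int n - j)] :: 'a fls) =
          - (bracket (n + 1) / bracket 1 ^ ((CARD('a) - 1) * CARD('a) ^ n)) *
          zeta [CARD('a) ^ (n + 2) - CARD('a) ^ nat (int n - j) - 1]"
    by (intro zeta_identity_6) linarith+
qed (rule zeta_identity_3 zeta_identity_4 zeta_identity_5)+

end
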